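(* Let $\Phi:\mathbb{C}_+\to\mathbb{C}_+$ be analytic. Then the following statements are equivalent: (a) $\Phi$ defines a bounded composition operator $C_\Phi$, $C_\Phi f=f\circ\Phi$, from $\mathcal{A}(\mathbb{C}_+)$ into itself. (b) $\Phi\in\mathcal{G}_{\mathcal{A}}$. (c) $n^{-\Phi}\in\mathcal{A}(\mathbb{C}_+)$ for all $n\in\mathbb{N}$. (d) $\Phi\in\mathcal{G}_\infty$ and $n^{-\Phi}\in\mathcal{A}(\mathbb{C}_+)$ for all $n\in\mathbb{N}$. (e) $\Phi\in\mathcal{G}_\infty$ and there exists some integer $n\ge2$ such that $n^{-\Phi}\in\mathcal{A}(\mathbb{C}_+)$.
   Context: $\mathbb{N}=\{1,2,\dots\}$. For $\theta\in\mathbb{R}$, $\mathbb{C}_\theta=\{s\in\mathbb{C}:\mathrm{Re}(s)>\theta\}$ and $\mathbb{C}_+=\mathbb{C}_0$. $\mathcal{D}$ is the set of Dirichlet series $\sum_{n\ge1}a_nn^{-s}$ that converge in some half-plane $\mathbb{C}_\theta$; an analytic function on $\mathbb{C}_+$ is said to be in $\mathcal{D}$ if it coincides with such a series on some half-plane. $\mathcal{A}(\mathbb{C}_+)$ (the algebra of Dirichlet series) is the set of Dirichlet series convergent in $\mathbb{C}_+$ whose sum is a uniformly continuous function on $\mathbb{C}_+$; it is a Banach algebra with the norm $\|f\|_\infty=\sup_{s\in\mathbb{C}_+}|f(s)|$. An analytic $\Phi:\mathbb{C}_+\to\mathbb{C}_+$ is in $\mathcal{G}_\infty$ if there are $c_\Phi\in\mathbb{N}\cup\{0\}$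 and $\varphi\in\mathcal{D}$ with $\Phi(s)=c_\Phi s+\varphi(s)$. It is in $\mathcal{G}_{\mathcal{A}}$ if $\Phi\in\mathcal{G}_\infty$ and, for every $M>0$, $\Phi$ is uniformly continuous on $A_M=\{s\in\mathbb{C}_+:0<\mathrm{Re}(\Phi(s))<M\}$. $n^{-\Phi}$ denotes the function $s\mapsto n^{-\Phi(s)}=e^{-\Phi(s)\log n}$. *)

theory Defs
  imports "HOL-Analysis.Analysis"
begin

text \<open>
  Functions on the right half-plane are represented by total functions of type
  \<open>complex \<Rightarrow> complex\<close>, of which only the values on \<open>half_plane 0\<close> matter: membership in the
  function classes below, and the norm, do not depend on the values elsewhere.
\<close>

definition half_plane :: "real \<Rightarrow> complex set" where
  "half_plane \<theta> = {s. Re s > \<theta>}"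

text \<open>
  The function \<open>f\<close> is, on \<open>S\<close>, the pointwise sum of the Dirichlet series with coefficients
  \<open>a 1, a 2, \<dots>\<close>. Convergence is that of the ordered partial sums, not absolute convergence.
  The summation index is shifted by one, so \<open>a 0\<close> is irrelevant.
\<close>

definition has_dirichlet_series ::
    "(complex \<Rightarrow> complex) \<Rightarrow> (nat \<Rightarrow> complex) \<Rightarrow> complex set \<Rightarrow> bool" where
  "has_dirichlet_series f a S \<longleftrightarrow>
     (\<forall>s\<in>S. (\<lambda>k. a (Suc k) * of_nat (Suc k) powr (- s)) sums f s)"

text \<open>
  The condition \<open>\<theta> \<ge> 0\<close> only ensures that the two functions are compared where \<open>f\<close> is
  meaningful; any half-plane may be shrunk to such a one.
\<close>

definition dirichlet_fun :: "(complex \<Rightarrow> complex) set" where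
  "dirichlet_fun = {f. f analytic_on half_plane 0 \<and>
     (\<exists>a. \<exists>\<theta>\<ge>0. has_dirichlet_series f a (half_plane \<theta>))}"

definition dirichlet_algebra :: "(complex \<Rightarrow> complex) set" where
  "dirichlet_algebra = {f. (\<exists>a. has_dirichlet_series f a (half_plane 0)) \<and>
     uniformly_continuous_on (half_plane 0) f}"

text \<open>
  Every member of \<open>dirichlet_algebra\<close> is bounded on \<open>half_plane 0\<close> (it is bounded far to the
  right by absolute convergence, and on the remaining strip by uniform continuity), so the
  supremum below is a genuine one there.
\<close>

definition half_plane_norm :: "(complex \<Rightarrow> complex) \<Rightarrow> real" where
  "half_plane_norm f = (SUP s\<in>half_plane 0. norm (f s))"

definition bounded_operator_on_algebra ::
    "((complex \<Rightarrow> complex) \<Rightarrow> complex \<Rightarrow> complex) \<Rightarrow> bool" where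
  "bounded_operator_on_algebra T \<longleftrightarrow>
     (\<forall>f\<in>dirichlet_algebra. T f \<in> dirichlet_algebra) \<and>
     (\<forall>f\<in>dirichlet_algebra. \<forall>g\<in>dirichlet_algebra. \<forall>s\<in>half_plane 0.
        T (\<lambda>z. f z + g z) s = T f s + T g s) \<and>
     (\<forall>c. \<forall>f\<in>dirichlet_algebra. \<forall>s\<in>half_plane 0. T (\<lambda>z. c * f z) s = c * T f s) \<and>
     (\<exists>K. \<forall>f\<in>dirichlet_algebra. half_plane_norm (T f) \<le> K * half_plane_norm f)"

definition composition_operator ::
    "(complex \<Rightarrow> complex) \<Rightarrow> (complex \<Rightarrow> complex) \<Rightarrow> complex \<Rightarrow> complex" where
  "composition_operator \<Phi> f = f \<circ> \<Phi>"

definition G_infinity :: "(complex \<Rightarrow> complex) set" where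
  "G_infinity = {\<Phi>. \<Phi> analytic_on half_plane 0 \<and> \<Phi> ` half_plane 0 \<subseteq> half_plane 0 \<and>
     (\<exists>c::nat. \<exists>\<phi>\<in>dirichlet_fun. \<forall>s\<in>half_plane 0. \<Phi> s = of_nat c * s + \<phi> s)}"

definition G_algebra :: "(complex \<Rightarrow> complex) set" where
  "G_algebra = {\<Phi>\<in>G_infinity. \<forall>M>0.
     uniformly_continuous_on {s\<in>half_plane 0. 0 < Re (\<Phi> s) \<and> Re (\<Phi> s) < M} \<Phi>}"

text \<open>
  For \<open>n \<ge> 1\<close> this is \<open>exp (- \<Phi> s * ln n)\<close>. For \<open>n = 0\<close> the library's \<open>powr\<close> gives the
  zero function, hence the explicit lower bounds on \<open>n\<close> where it is used.
\<close>

definition nat_powr_neg :: "nat \<Rightarrow> (complex \<Rightarrow> complex) \<Rightarrow> complex \<Rightarrow> complex" where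
  "nat_powr_neg n \<Phi> = (\<lambda>s. of_nat n powr (- \<Phi> s))"

end

theory Submission
  imports Defs "HOL-Complex_Analysis.Complex_Analysis" "HOL-Real_Asymp.Real_Asymp"
begin

text \<open>
  From (c) to (d): taking the logarithm of \<open>n powr (- \<Phi>)\<close> after extracting its leading term
  \<open>a * m powr (-s)\<close> gives \<open>\<Phi> s = (ln m / ln n) * s + \<psi> s\<close>, where \<open>\<psi>\<close> is a generalised Dirichlet series
  whose frequencies are logarithms of rationals with powers of \<open>m\<close> as denominators. The slope \<open>c\<close>
  does not depend on \<open>n\<close>, so \<open>n powr c\<close> is always an integer and \<open>c\<close> is a natural number; comparing
  \<open>n = 2\<close> and \<open>n = 3\<close> shows that \<open>\<psi>\<close> is an ordinary Dirichlet series.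

  From (e) to (b): on \<open>Re \<Phi> < M\<close> the modulus of \<open>n powr (- \<Phi>)\<close> is bounded below, so that one can take
  logarithms along short segments.

  From (b) to (a): an element \<open>f\<close> of the algebra has a limit at infinity, which together with the
  uniform continuity of \<open>\<Phi>\<close> where \<open>Re \<Phi>\<close> is bounded makes \<open>f \<circ> \<Phi>\<close> uniformly continuous. Far to the
  right \<open>f \<circ> \<Phi>\<close> is an absolutely convergent Dirichlet series, and since it is bounded, Bohr's theorem
  gives convergence in the whole half-plane.
\<close>

section \<open>Absolutely convergent generalised Dirichlet series\<close>

text \<open>A member of the algebra converges in \<open>half_plane 0\<close>, but absolute
  convergence is available only further to the right, so series cannot simply be multiplied or
  substituted in the whole half-plane. The algebraic manipulations therefore take place on some
  \<open>Re s \<ge> \<sigma>\<close> with \<sigma> as large as wanted, where frequencies bounded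
  away from 0 contribute arbitrarily little. Only Bohr's theorem leads back to
  \<open>half_plane 0\<close>.

  A single n does not force \<Phi> into \<open>G_infinity\<close>: for \<Phi> s = (ln 3 / ln 2) * s
  one has 2 powr (-\<Phi> s) = 3 powr (-s). Hence (e) assumes membership, while in (c) every n
  enters through the integrality of n powr c, and the denominators met for one n are removed by a
  second, coprime one.

  If c > 0, Re \<Phi> tends to infinity with Re s and f can be substituted term by term. If c = 0,
  \<Phi> tends to a constant b, and Re b > 0 is needed, not only Re b \<ge> 0. The leading
  nonconstant term of \<Phi>, if there is one, gives strictness: it rotates along vertical lines and
  somewhere brings Re \<Phi> down to at most Re b.\<close>

text \<open>
  A generalised Dirichlet series \<open>\<Sum>q. b q * q powr (-s)\<close> over a set \<open>Q\<close> of real numbers, indexed by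
  \<open>q\<close> itself instead of the frequency \<open>ln q\<close>. The number \<open>B\<close> bounds the sum of the absolute
  values on the line \<open>Re s = \<sigma>\<close>, a submultiplicative norm.
\<close>

definition abs_dirichlet :: "real set \<Rightarrow> real \<Rightarrow> real \<Rightarrow> (complex \<Rightarrow> complex) \<Rightarrow> bool" where
  "abs_dirichlet Q \<sigma> B f \<longleftrightarrow> (\<exists>b S. ((\<lambda>q. norm (b q) * q powr -\<sigma>) has_sum S) Q \<and> S \<le> B \<and>
     (\<forall>s. Re s \<ge> \<sigma> \<longrightarrow> ((\<lambda>q. b q * of_real q powr (-s)) has_sum f s) Q))"

text \<open>Multiplying series multiplies the \<open>q\<close>, so these sets support an algebra
  with unit. Since \<open>q \<ge> 1\<close>, \<open>q powr (- Re s)\<close> decreases in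
  \<open>Re s\<close>, and a bound on one vertical line holds everywhere to its right.\<close>

definition frequency_monoid :: "real set \<Rightarrow> bool" where
  "frequency_monoid Q \<longleftrightarrow> Q \<subseteq> {1..} \<and> 1 \<in> Q \<and> (\<forall>x\<in>Q. \<forall>y\<in>Q. x * y \<in> Q)"

lemma norm_dirichlet_term:
  "q > 0 \<Longrightarrow> norm (b * complex_of_real q powr (-s)) = norm b * q powr (- Re s)"
  by (simp add: norm_mult norm_powr_real_powr)

lemma powr_neg_antimono:
  "q \<ge> 1 \<Longrightarrow> x \<le> y \<Longrightarrow> q powr (-y) \<le> q powr (- x :: real)"
  by (rule powr_mono) auto

lemma dirichlet_terms_summable:
  fixes c :: "'i \<Rightarrow> complex" and q :: "'i \<Rightarrow> real"
  assumes "(\<lambda>i. norm (c i) * q i powr -\<sigma>) summable_on I" "\<And>i. i \<in> I \<Longrightarrow> q i \<ge> 1" "Re s \<ge> \<sigma>"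
  shows "(\<lambda>i. norm (c i * of_real (q i) powr (-s))) summable_on I"
  using assms(1)
proof (rule Infinite_Sum.abs_summable_on_comparison_test')
  fix i assume i: "i \<in> I"
  have "q i > 0" using assms(2)[OF i] by linarith
  then show "norm (c i * of_real (q i) powr (-s)) \<le> norm (c i) * q i powr -\<sigma>"
    using powr_neg_antimono[OF assms(2)[OF i] assms(3)]
    by (simp add: norm_dirichlet_term mult_left_mono)
qed

text \<open>Several indices \<open>i\<close> may share one value \<open>q i\<close>; collecting the
  terms over each fibre \<open>J r\<close> can only lower the sum of absolute values, by the
  triangle inequality. Infinite sums, products and rescaled frequencies all reduce to this.\<close>

lemma abs_dirichlet_regroup:
  fixes c :: "'i \<Rightarrow> complex" and q :: "'i \<Rightarrow> real"
  assumes "((\<lambda>i. norm (c i) * q i powr -\<sigma>) has_sum S) I" "S \<le> B"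
    and qQ: "\<And>i. i \<in> I \<Longrightarrow> q i \<in> Q" and Q: "Q \<subseteq> {1..}"
    and f: "\<And>s. Re s \<ge> \<sigma> \<Longrightarrow> ((\<lambda>i. c i * of_real (q i) powr (-s)) has_sum f s) I"
  shows "abs_dirichlet Q \<sigma> B f"
proof -
  define J where "J r = {i\<in>I. q i = r}" for r
  have bij: "bij_betw snd (Sigma Q J) I"
    unfolding bij_betw_def inj_on_def J_def using qQ by (auto simp: image_iff)
  have reindex: "(h has_sum T) I \<longleftrightarrow> ((\<lambda>p. h (snd p)) has_sum T) (Sigma Q J)"
    for h :: "'i \<Rightarrow> 'b :: {comm_monoid_add, topological_space}" and T
    using has_sum_reindex_bij_betw[OF bij, of h T] by simp
  have norm_sum: "((\<lambda>p. norm (c (snd p)) * q (snd p) powr -\<sigma>) has_sum S) (Sigma Q J)"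
    using assms(1) by (subst (asm) reindex)
  have fibre: "(\<lambda>i. norm (c i)) summable_on J r" if "r \<in> Q" for r
  proof -
    have "(\<lambda>i. norm (c i) * q i powr -\<sigma>) summable_on J r"
      by (rule summable_on_subset_banach[OF has_sum_imp_summable[OF assms(1)]]) (auto simp: J_def)
    then have "(\<lambda>i. norm (c i) * q i powr -\<sigma> * r powr \<sigma>) summable_on J r"
      by (rule summable_on_cmult_left)
    moreover have "norm (c i) * q i powr -\<sigma> * r powr \<sigma> = norm (c i)" if "i \<in> J r" for i
      using that \<open>r \<in> Q\<close> Q by (auto simp: J_def powr_minus field_simps)
    ultimately show ?thesis by (simp cong: summable_on_cong)
  qed
  define b where "b r = infsum c (J r)" for r
  define g where "g r = infsum (\<lambda>i. norm (c i)) (J r) * r powr -\<sigma>" for r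
  have "((\<lambda>i. norm (c i) * q i powr -\<sigma>) has_sum g r) (J r)" if "r \<in> Q" for r
  proof -
    have "((\<lambda>i. norm (c i) * r powr -\<sigma>) has_sum g r) (J r)"
      unfolding g_def using fibre[OF that] by (intro has_sum_cmult_left has_sum_infsum)
    then show ?thesis by (rule has_sum_cong[THEN iffD1, rotated]) (auto simp: J_def)
  qed
  then have gsum: "(g has_sum S) Q"
    by (intro has_sum_SigmaD[OF norm_sum]) auto
  have bg: "norm (b r) * r powr -\<sigma> \<le> g r" if "r \<in> Q" for r
    unfolding b_def g_def using norm_infsum_bound[OF fibre[OF that]] by (intro mult_right_mono) auto
  have bsum: "(\<lambda>r. norm (b r) * r powr -\<sigma>) summable_on Q"
    by (rule summable_on_comparison_test[OF has_sum_imp_summable[OF gsum] bg]) auto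
  have "infsum (\<lambda>r. norm (b r) * r powr -\<sigma>) Q \<le> S"
    using infsum_mono[OF bsum has_sum_imp_summable[OF gsum] bg] gsum by (simp add: infsumI)
  moreover have "((\<lambda>r. b r * of_real r powr (-s)) has_sum f s) Q" if s: "Re s \<ge> \<sigma>" for s
  proof (rule has_sum_SigmaD)
    show "((\<lambda>p. c (snd p) * of_real (q (snd p)) powr (-s)) has_sum f s) (Sigma Q J)"
      using f[OF s] by (subst (asm) reindex)
    fix r assume r: "r \<in> Q"
    have "((\<lambda>i. c i * of_real r powr (-s)) has_sum b r * of_real r powr (-s)) (J r)"
      unfolding b_def using Infinite_Sum.abs_summable_summable[OF fibre[OF r]]
      by (intro has_sum_cmult_left has_sum_infsum)
    then show "((\<lambda>i. c (snd (r, i)) * of_real (q (snd (r, i))) powr (-s)) has_sum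
        b r * of_real r powr (-s)) (J r)"
      by (rule has_sum_cong[THEN iffD1, rotated]) (auto simp: J_def)
  qed
  ultimately show ?thesis
    unfolding abs_dirichlet_def using has_sum_infsum[OF bsum] \<open>S \<le> B\<close> by (meson order_trans)
qed

lemma abs_dirichlet_mono:
  assumes "abs_dirichlet Q \<sigma> B f" "Q \<subseteq> Q'" "Q' \<subseteq> {1..}" "\<sigma> \<le> \<sigma>'" "B \<le> B'"
  shows "abs_dirichlet Q' \<sigma>' B' f"
proof -
  from assms(1) obtain b S where b: "((\<lambda>q. norm (b q) * q powr -\<sigma>) has_sum S) Q" "S \<le> B"
     "\<And>s. Re s \<ge> \<sigma> \<Longrightarrow> ((\<lambda>q. b q * of_real q powr (-s)) has_sum f s) Q"
    unfolding abs_dirichlet_def by blast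
  have le: "norm (b q) * q powr -\<sigma>' \<le> norm (b q) * q powr -\<sigma>" if "q \<in> Q" for q
    using that assms(2-4) powr_neg_antimono[of q \<sigma> \<sigma>'] by (intro mult_left_mono) auto
  have sm: "(\<lambda>q. norm (b q) * q powr -\<sigma>') summable_on Q"
    by (rule summable_on_comparison_test[OF has_sum_imp_summable[OF b(1)] le]) auto
  have "infsum (\<lambda>q. norm (b q) * q powr -\<sigma>') Q \<le> S"
    using infsum_mono[OF sm has_sum_imp_summable[OF b(1)] le] b(1) by (simp add: infsumI)
  then show ?thesis
    using assms b sm
    by (intro abs_dirichlet_regroup[where c = b and q = "\<lambda>q. q" and I = Q
          and S = "infsum (\<lambda>q. norm (b q) * q powr -\<sigma>') Q"]) auto
qed

lemma abs_dirichlet_bound: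
  assumes "abs_dirichlet Q \<sigma> B f" "Q \<subseteq> {1..}" "Re s \<ge> \<sigma>"
  shows "norm (f s) \<le> B"
proof -
  from assms(1) obtain b S where b: "((\<lambda>q. norm (b q) * q powr -\<sigma>) has_sum S) Q" "S \<le> B"
     "\<And>s. Re s \<ge> \<sigma> \<Longrightarrow> ((\<lambda>q. b q * of_real q powr (-s)) has_sum f s) Q"
    unfolding abs_dirichlet_def by blast
  have ab: "(\<lambda>q. norm (b q * of_real q powr (-s))) summable_on Q"
    by (rule dirichlet_terms_summable[OF has_sum_imp_summable[OF b(1)]]) (use assms in auto)
  have "norm (f s) \<le> infsum (\<lambda>q. norm (b q * of_real q powr (-s))) Q"
    using norm_infsum_bound[OF ab] b(3)[OF assms(3)] by (simp add: infsumI)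
  also have "\<dots> \<le> infsum (\<lambda>q. norm (b q) * q powr -\<sigma>) Q"
  proof (rule infsum_mono[OF ab has_sum_imp_summable[OF b(1)]])
    fix q assume "q \<in> Q"
    then have "q \<ge> 1" using assms by auto
    then show "norm (b q * of_real q powr (-s)) \<le> norm (b q) * q powr -\<sigma>"
      using powr_neg_antimono[of q \<sigma> "Re s"] assms by (simp add: norm_dirichlet_term mult_left_mono)
  qed
  also have "\<dots> \<le> B" using b by (simp add: infsumI)
  finally show ?thesis .
qed

lemma abs_dirichlet_cong:
  assumes "abs_dirichlet Q \<sigma> B f" "\<And>s. Re s \<ge> \<sigma> \<Longrightarrow> f s = g s"
  shows "abs_dirichlet Q \<sigma> B g"
  using assms unfolding abs_dirichlet_def by metis

lemma abs_dirichlet_term: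
  assumes "r \<in> Q" "Q \<subseteq> {1..}" "norm a * r powr -\<sigma> \<le> B"
  shows "abs_dirichlet Q \<sigma> B (\<lambda>s. a * of_real r powr (-s))"
  by (rule abs_dirichlet_regroup[where c = "\<lambda>_::unit. a" and q = "\<lambda>_. r" and I = UNIV])
     (use assms in \<open>auto intro!: has_sum_finiteI\<close>)

lemma abs_dirichlet_const:
  assumes "frequency_monoid Q" "norm a \<le> B"
  shows "abs_dirichlet Q \<sigma> B (\<lambda>s. a)"
  using abs_dirichlet_term[of 1 Q a \<sigma> B] assms by (auto simp: frequency_monoid_def)

lemma abs_dirichlet_cmult:
  assumes "abs_dirichlet Q \<sigma> B f"
  shows "abs_dirichlet Q \<sigma> (norm a * B) (\<lambda>s. a * f s)"
proof -
  from assms obtain b S where b: "((\<lambda>q. norm (b q) * q powr -\<sigma>) has_sum S) Q" "S \<le> B"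
     "\<And>s. Re s \<ge> \<sigma> \<Longrightarrow> ((\<lambda>q. b q * of_real q powr (-s)) has_sum f s) Q"
    unfolding abs_dirichlet_def by blast
  show ?thesis
    unfolding abs_dirichlet_def
    using has_sum_cmult_right[OF b(1), of "norm a"] has_sum_cmult_right[OF b(3), of _ a]
    by (intro exI[of _ "\<lambda>q. a * b q"] exI[of _ "norm a * S"])
       (auto simp: norm_mult mult.assoc b mult_left_mono)
qed

lemma abs_dirichlet_add:
  assumes "abs_dirichlet Q \<sigma> B f" "abs_dirichlet Q \<sigma> C g" "Q \<subseteq> {1..}"
  shows "abs_dirichlet Q \<sigma> (B + C) (\<lambda>s. f s + g s)"
proof -
  from assms(1) obtain b S where b: "((\<lambda>q. norm (b q) * q powr -\<sigma>) has_sum S) Q" "S \<le> B"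
     "\<And>s. Re s \<ge> \<sigma> \<Longrightarrow> ((\<lambda>q. b q * of_real q powr (-s)) has_sum f s) Q"
    unfolding abs_dirichlet_def by blast
  from assms(2) obtain c T where c: "((\<lambda>q. norm (c q) * q powr -\<sigma>) has_sum T) Q" "T \<le> C"
     "\<And>s. Re s \<ge> \<sigma> \<Longrightarrow> ((\<lambda>q. c q * of_real q powr (-s)) has_sum g s) Q"
    unfolding abs_dirichlet_def by blast
  let ?n = "\<lambda>q. norm (b q + c q) * q powr -\<sigma>"
  have le: "?n q \<le> norm (b q) * q powr -\<sigma> + norm (c q) * q powr -\<sigma>" for q
    using mult_right_mono[OF norm_triangle_ineq[of "b q" "c q"], of "q powr -\<sigma>"]
    by (simp add: algebra_simps)
  have st: "((\<lambda>q. norm (b q) * q powr -\<sigma> + norm (c q) * q powr -\<sigma>) has_sum S + T) Q"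
    using b c by (intro has_sum_add)
  have sm: "?n summable_on Q"
    by (rule summable_on_comparison_test[OF has_sum_imp_summable[OF st] le]) auto
  have "infsum ?n Q \<le> S + T"
    using infsum_mono[OF sm has_sum_imp_summable[OF st] le] st by (simp add: infsumI)
  then show ?thesis
    unfolding abs_dirichlet_def using sm b c has_sum_add[OF b(3) c(3)]
    by (intro exI[of _ "\<lambda>q. b q + c q"] exI[of _ "infsum ?n Q"]) (auto simp: algebra_simps)
qed

text \<open>Completeness of the norm: the terms of all \<open>F k\<close> form an absolutely
  summable family over pairs, so the order of summation can be exchanged before equal frequencies
  are collected.\<close>

lemma abs_dirichlet_sums:
  fixes F :: "nat \<Rightarrow> complex \<Rightarrow> complex"
  assumes "\<And>k. abs_dirichlet Q \<sigma> (B k) (F k)" "summable B" "Q \<subseteq> {1..}"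
    and sums: "\<And>s. Re s \<ge> \<sigma> \<Longrightarrow> (\<lambda>k. F k s) sums G s"
  shows "abs_dirichlet Q \<sigma> (suminf B) G"
proof -
  have "\<forall>k. \<exists>p. ((\<lambda>q. norm (fst p q) * q powr -\<sigma>) has_sum snd p) Q \<and> snd p \<le> B k \<and>
     (\<forall>s. Re s \<ge> \<sigma> \<longrightarrow> ((\<lambda>q. fst p q * of_real q powr (-s)) has_sum F k s) Q)"
    using assms(1) unfolding abs_dirichlet_def by force
  from choice[OF this] obtain p where p: "\<forall>k. ((\<lambda>q. norm (fst (p k) q) * q powr -\<sigma>) has_sum snd (p k)) Q \<and>
     snd (p k) \<le> B k \<and> (\<forall>s. Re s \<ge> \<sigma> \<longrightarrow> ((\<lambda>q. fst (p k) q * of_real q powr (-s)) has_sum F k s) Q)"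
    by blast
  define b S where "b k = fst (p k)" and "S k = snd (p k)" for k
  have b: "\<And>k. ((\<lambda>q. norm (b k q) * q powr -\<sigma>) has_sum S k) Q" "\<And>k. S k \<le> B k"
     "\<And>k s. Re s \<ge> \<sigma> \<Longrightarrow> ((\<lambda>q. b k q * of_real q powr (-s)) has_sum F k s) Q"
    unfolding b_def S_def using p by auto
  have S0: "S k \<ge> 0" for k using b(1)[of k] by (rule has_sum_nonneg) auto
  have Ssum: "summable S" using S0 b(2) by (intro summable_comparison_test'[OF assms(2)]) auto
  then have "S sums suminf S" by auto
  then have "(S has_sum suminf S) UNIV"
    using S0 by (intro sums_nonneg_imp_has_sum)
  let ?I = "(UNIV :: nat set) \<times> Q"
  have n1: "(\<lambda>p. norm (b (fst p) (snd p)) * snd p powr -\<sigma>) summable_on ?I"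
    by (rule summable_on_SigmaI[where g = S])
       (use b(1) \<open>(S has_sum suminf S) UNIV\<close> in \<open>auto intro: has_sum_imp_summable\<close>)
  have n2: "((\<lambda>p. norm (b (fst p) (snd p)) * snd p powr -\<sigma>) has_sum suminf S) ?I"
    by (rule has_sum_SigmaI[OF _ \<open>(S has_sum suminf S) UNIV\<close> n1]) (use b(1) in auto)
  show ?thesis
  proof (rule abs_dirichlet_regroup[OF n2])
    show "suminf S \<le> suminf B" using b(2) Ssum assms(2) by (rule suminf_le)
    fix s assume s: "Re s \<ge> \<sigma>"
    have "(\<lambda>p. norm (b (fst p) (snd p) * of_real (snd p) powr (-s))) summable_on ?I"
      by (rule dirichlet_terms_summable[OF n1]) (use assms(3) s in auto)
    then have h: "((\<lambda>p. b (fst p) (snd p) * of_real (snd p) powr (-s)) has_sum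
        infsum (\<lambda>p. b (fst p) (snd p) * of_real (snd p) powr (-s)) ?I) ?I"
      (is "(_ has_sum ?T) _")
      by (rule has_sum_infsum[OF Infinite_Sum.abs_summable_summable])
    have "((\<lambda>k. F k s) has_sum ?T) UNIV"
      by (rule has_sum_SigmaD[OF h]) (use b(3)[OF s] in auto)
    then have "?T = G s"
      using sums_unique2[OF has_sum_imp_sums sums[OF s]] by simp
    then show "((\<lambda>p. b (fst p) (snd p) * of_real (snd p) powr (-s)) has_sum G s) ?I"
      using h by simp
  qed (use assms(3) in auto)
qed

text \<open>Dirichlet convolution over pairs of frequencies; the weight
  \<open>q powr -\<sigma>\<close> is multiplicative, so the double sum of absolute values factors as
  \<open>S * T\<close>.\<close>

lemma abs_dirichlet_mult:
  assumes "abs_dirichlet Q \<sigma> B f" "abs_dirichlet Q \<sigma> C g" "frequency_monoid Q"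
  shows "abs_dirichlet Q \<sigma> (B * C) (\<lambda>s. f s * g s)"
proof -
  have Q: "Q \<subseteq> {1..}" using assms(3) by (simp add: frequency_monoid_def)
  from assms(1) obtain b S where b: "((\<lambda>q. norm (b q) * q powr -\<sigma>) has_sum S) Q" "S \<le> B"
     "\<And>s. Re s \<ge> \<sigma> \<Longrightarrow> ((\<lambda>q. b q * of_real q powr (-s)) has_sum f s) Q"
    unfolding abs_dirichlet_def by blast
  from assms(2) obtain c T where c: "((\<lambda>q. norm (c q) * q powr -\<sigma>) has_sum T) Q" "T \<le> C"
     "\<And>s. Re s \<ge> \<sigma> \<Longrightarrow> ((\<lambda>q. c q * of_real q powr (-s)) has_sum g s) Q"
    unfolding abs_dirichlet_def by blast
  have S0: "S \<ge> 0" using b(1) by (rule has_sum_nonneg) auto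
  have T0: "T \<ge> 0" using c(1) by (rule has_sum_nonneg) auto
  let ?c = "\<lambda>p. b (fst p) * c (snd p)" and ?q = "\<lambda>p. fst p * snd p :: real"
  have split: "norm (?c (x, y)) * ?q (x, y) powr -\<sigma> = (norm (b x) * x powr -\<sigma>) * (norm (c y) * y powr -\<sigma>)"
    if "x \<in> Q" "y \<in> Q" for x y
    using that Q by (auto simp: norm_mult powr_mult)
  have in1: "((\<lambda>y. norm (?c (x, y)) * ?q (x, y) powr -\<sigma>) has_sum (norm (b x) * x powr -\<sigma>) * T) Q"
    if "x \<in> Q" for x
    using has_sum_cmult_right[OF c(1), of "norm (b x) * x powr -\<sigma>"] split[OF that]
    by (subst has_sum_cong[OF split[OF that]]) auto
  have out1: "((\<lambda>x. (norm (b x) * x powr -\<sigma>) * T) has_sum S * T) Q"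
    using b(1) by (rule has_sum_cmult_left)
  have n1: "(\<lambda>p. norm (?c p) * ?q p powr -\<sigma>) summable_on Q \<times> Q"
    by (rule summable_on_SigmaI[OF in1 has_sum_imp_summable[OF out1]]) auto
  have n2: "((\<lambda>p. norm (?c p) * ?q p powr -\<sigma>) has_sum S * T) (Q \<times> Q)"
    by (rule has_sum_SigmaI[OF in1 out1 n1])
  show ?thesis
  proof (rule abs_dirichlet_regroup[OF n2])
    show "S * T \<le> B * C" using b(2) c(2) S0 T0 by (intro mult_mono) auto
    show q: "?q p \<in> Q" if "p \<in> Q \<times> Q" for p
      using that assms(3) by (auto simp: frequency_monoid_def)
    fix s assume s: "Re s \<ge> \<sigma>"
    have "(\<lambda>p. norm (?c p * of_real (?q p) powr (-s))) summable_on Q \<times> Q"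
      by (rule dirichlet_terms_summable[OF n1]) (use q Q s in \<open>auto simp: subset_iff\<close>)
    then have "(\<lambda>p. ?c p * of_real (?q p) powr (-s)) summable_on Q \<times> Q"
      by (rule Infinite_Sum.abs_summable_summable)
    moreover have "((\<lambda>y. ?c (x, y) * of_real (?q (x, y)) powr (-s)) has_sum
        (b x * of_real x powr (-s)) * g s) Q" if "x \<in> Q" for x
    proof -
      have "?c (x, y) * of_real (?q (x, y)) powr (-s) =
          (b x * of_real x powr (-s)) * (c y * of_real y powr (-s))" if "y \<in> Q" for y
      proof -
        have "0 \<le> x" "0 \<le> y" using \<open>x \<in> Q\<close> that Q by auto
        then show ?thesis by (simp add: powr_times_real)
      qed
      then show ?thesis
        using has_sum_cmult_right[OF c(3)[OF s], of "b x * of_real x powr (-s)"]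
        by (subst has_sum_cong) auto
    qed
    moreover have "((\<lambda>x. (b x * of_real x powr (-s)) * g s) has_sum f s * g s) Q"
      using b(3)[OF s] by (rule has_sum_cmult_left)
    ultimately show "((\<lambda>p. ?c p * of_real (?q p) powr (-s)) has_sum f s * g s) (Q \<times> Q)"
      by (intro has_sum_SigmaI)
  qed (rule Q)
qed

lemma abs_dirichlet_power:
  assumes "abs_dirichlet Q \<sigma> B f" "frequency_monoid Q"
  shows "abs_dirichlet Q \<sigma> (B ^ k) (\<lambda>s. f s ^ k)"
proof (induction k)
  case 0
  show ?case using abs_dirichlet_const[OF assms(2), of 1] by simp
next
  case (Suc k)
  show ?case using abs_dirichlet_mult[OF assms(1) Suc assms(2)] by simp
qed

text \<open>A power series that converges absolutely at the norm bound \<open>B\<close> can be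
  applied to \<open>f\<close>. This serves for the exponential, the logarithm and the Taylor series
  of an outer function.\<close>

lemma abs_dirichlet_power_series:
  assumes "abs_dirichlet Q \<sigma> B f" "frequency_monoid Q" "summable (\<lambda>k. norm (d k) * B ^ k)"
    and "\<And>s. Re s \<ge> \<sigma> \<Longrightarrow> (\<lambda>k. d k * f s ^ k) sums G s"
  shows "abs_dirichlet Q \<sigma> (\<Sum>k. norm (d k) * B ^ k) G"
  using assms(2,3)
  by (intro abs_dirichlet_sums[where F = "\<lambda>k s. d k * f s ^ k", OF abs_dirichlet_cmult[OF abs_dirichlet_power[OF assms(1,2)]] _ _ assms(4)])
     (auto simp: frequency_monoid_def)

section \<open>Uniqueness of coefficients\<close>

text \<open>
  Averaging a trigonometric polynomial with its translate by a suitable \<open>h\<close>, with phases aligned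
  to the frequency \<open>l r\<close>, removes one other frequency and preserves the coefficient \<open>e\<close> and the bound.
\<close>

lemma trigonometric_coefficient_bound:
  fixes d :: "'a \<Rightarrow> complex" and l :: "'a \<Rightarrow> real"
  assumes "finite J" "r \<notin> J" "inj_on l (insert r J)"
    and "\<And>t. norm ((\<Sum>q\<in>J. d q * cis (l q * t)) + e * cis (l r * t)) \<le> \<epsilon>"
  shows "norm e \<le> \<epsilon>"
  using assms
proof (induction J arbitrary: d rule: finite_induct)
  case empty
  then show ?case using empty.prems(3)[of 0] by simp
next
  case (insert p J)
  \<comment> \<open>At this \<open>h\<close> the factor \<open>1 + cis ((l p - l r) * h)\<close> is
    1 + cis pi = 0, which kills the frequency \<open>l p\<close>, while the factor at
    \<open>l r\<close> is (1 + 1) / 2 = 1.\<close>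
  define h where "h = pi / (l p - l r)"
  define d' where "d' q = d q * (1 + cis ((l q - l r) * h)) / 2" for q
  let ?P = "\<lambda>t. (\<Sum>q\<in>insert p J. d q * cis (l q * t)) + e * cis (l r * t)"
  have neq: "l p \<noteq> l r" using insert.prems by (auto simp: inj_on_def)
  then have kill: "d' p = 0" by (simp add: d'_def h_def)
  show ?case
  proof (rule insert.IH)
    fix t
    have tw: "cis (- (l r * h)) * (x * cis (k * (t + h))) = x * cis ((k - l r) * h) * cis (k * t)" for x k
      by (simp add: cis_mult ring_distribs mult.left_commute[of _ x] mult.assoc)
        (simp add: algebra_simps)
    have "(\<Sum>q\<in>J. d' q * cis (l q * t)) + e * cis (l r * t) =
        (\<Sum>q\<in>insert p J. d' q * cis (l q * t)) + e * cis (l r * t)"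
      using insert.hyps kill by simp
    also have "\<dots> = (?P t + cis (- (l r * h)) * ?P (t + h)) / 2"
      unfolding distrib_left[of "cis (- (l r * h))"] sum_distrib_left tw d'_def
      by (simp add: sum.distrib[symmetric] algebra_simps sum_divide_distrib add_divide_distrib del: sum.insert)
    also have "norm \<dots> \<le> (norm (?P t) + norm (?P (t + h))) / 2"
      using norm_triangle_ineq[of "?P t" "cis (- (l r * h)) * ?P (t + h)"]
      by (simp add: norm_mult norm_divide del: sum.insert)
    also have "\<dots> \<le> \<epsilon>" using add_mono[OF insert.prems(3)[of t] insert.prems(3)[of "t + h"]] by (simp del: sum.insert)
    finally show "norm ((\<Sum>q\<in>J. d' q * cis (l q * t)) + e * cis (l r * t)) \<le> \<epsilon>" .
  qed (use insert.prems in \<open>auto intro: inj_on_subset\<close>)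
qed

text \<open>On the line \<open>Re s = \<sigma>\<close> this is an absolutely convergent
  trigonometric series with frequencies \<open>- ln q\<close>. Outside a finite set the terms have
  total size at most \<epsilon>, so the finite part is bounded by \<epsilon>, and so is its
  coefficient at \<open>r\<close>.\<close>

lemma dirichlet_coefficients_zero:
  assumes Q: "Q \<subseteq> {1..}" and sm: "(\<lambda>q. norm (b q) * q powr -\<sigma>) summable_on Q"
    and zero: "\<And>s. Re s = \<sigma> \<Longrightarrow> ((\<lambda>q. b q * of_real q powr (-s)) has_sum (0::complex)) Q"
    and r: "r \<in> Q"
  shows "b r = 0"
proof -
  define d where "d q = b q * of_real (q powr -\<sigma>)" for q
  have nd: "norm (d q) = norm (b q) * q powr -\<sigma>" for q by (simp add: d_def norm_mult)
  have dsum: "(\<lambda>q. norm (d q)) summable_on Q" using sm by (simp add: nd)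
  have terms: "b q * of_real q powr (- Complex \<sigma> t) = d q * cis (- ln q * t)" if "q \<in> Q" for q t
  proof -
    have "q > 0" using that Q by force
    then show ?thesis
      by (simp add: d_def powr_def Complex_eq algebra_simps exp_diff exp_minus cis_conv_exp
          exp_of_real[symmetric] Ln_of_real divide_inverse)
  qed
  have bound: "norm (d r) \<le> \<epsilon>" if "\<epsilon> > 0" for \<epsilon>
  proof -
    obtain F where F: "finite F" "F \<subseteq> Q" "dist (\<Sum>q\<in>F. norm (d q)) (infsum (\<lambda>q. norm (d q)) Q) \<le> \<epsilon>"
      using infsum_finite_approximation[OF dsum \<open>\<epsilon> > 0\<close>] by blast
    define J where "J = F - {r}"
    have J: "finite J" "insert r J \<subseteq> Q" "r \<notin> J" "F \<subseteq> insert r J" using F r by (auto simp: J_def)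
    have un: "insert r J \<union> (Q - insert r J) = Q" using J by blast
    have tail_sm: "(\<lambda>q. norm (d q)) summable_on Q - insert r J"
      by (rule summable_on_subset_banach[OF dsum]) auto
    have "infsum (\<lambda>q. norm (d q)) Q = (\<Sum>q\<in>insert r J. norm (d q)) + infsum (\<lambda>q. norm (d q)) (Q - insert r J)"
      using infsum_Un_disjoint[of "\<lambda>q. norm (d q)" "insert r J" "Q - insert r J"] J tail_sm
      unfolding un by simp
    moreover have "(\<Sum>q\<in>F. norm (d q)) \<le> (\<Sum>q\<in>insert r J. norm (d q))"
      using J by (intro sum_mono2) auto
    ultimately have tail: "infsum (\<lambda>q. norm (d q)) (Q - insert r J) \<le> \<epsilon>"
      using F(3) by (simp add: dist_real_def abs_le_iff del: sum.insert)
    show "norm (d r) \<le> \<epsilon>"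
    proof (rule trigonometric_coefficient_bound[where l = "\<lambda>q. - ln q" and J = J and r = r])
      show "inj_on (\<lambda>q. - ln q) (insert r J)"
      proof (rule inj_onI)
        fix x y assume "x \<in> insert r J" "y \<in> insert r J" and eq: "- ln x = - ln y"
        then have "x > 0" "y > 0" using J(2) Q by force+
        with eq show "x = y" by simp
      qed
      fix t
      let ?g = "\<lambda>q. d q * cis (- ln q * t)"
      have g0: "(?g has_sum 0) Q"
        using has_sum_cong[of Q "\<lambda>q. b q * of_real q powr (- Complex \<sigma> t)" ?g 0] terms[of _ t]
          zero[of "Complex \<sigma> t"] by simp
      have gs: "(\<lambda>q. norm (?g q)) summable_on Q - insert r J"
        using tail_sm by (simp add: norm_mult)
      have "0 = infsum ?g Q" using g0 by (simp add: infsumI)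
      also have "\<dots> = sum ?g (insert r J) + infsum ?g (Q - insert r J)"
        using infsum_Un_disjoint[of ?g "insert r J" "Q - insert r J"] J
          Infinite_Sum.abs_summable_summable[OF gs]
        unfolding un by simp
      finally have "sum ?g J + d r * cis (- ln r * t) = - infsum ?g (Q - insert r J)"
        using J by (simp add: add_eq_0_iff add.commute)
      then have "norm (sum ?g J + d r * cis (- ln r * t)) = norm (infsum ?g (Q - insert r J))"
        by simp
      also have "\<dots> \<le> infsum (\<lambda>q. norm (?g q)) (Q - insert r J)"
        by (rule norm_infsum_bound[OF gs])
      also have "\<dots> \<le> \<epsilon>" using tail by (simp add: norm_mult)
      finally show "norm (sum ?g J + d r * cis (- ln r * t)) \<le> \<epsilon>" .
    qed (use J in auto)
  qed
  have "norm (d r) = 0" using bound by (metis dense_ge norm_ge_zero antisym)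
  moreover have "r > 0" using r Q by force
  ultimately show ?thesis by (simp add: d_def)
qed

text \<open>Extended by zero to \<open>Q \<union> R\<close>, both expansions have the same
  coefficients by uniqueness, so those over \<open>Q\<close> vanish outside \<open>R\<close>. This
  is how two kinds of denominators are played against each other.\<close>

lemma abs_dirichlet_Int:
  assumes "abs_dirichlet Q \<sigma> B f" "abs_dirichlet R \<sigma> C f" "Q \<subseteq> {1..}" "R \<subseteq> {1..}"
  shows "abs_dirichlet (Q \<inter> R) \<sigma> B f"
proof -
  from assms(1) obtain b S where b: "((\<lambda>q. norm (b q) * q powr -\<sigma>) has_sum S) Q" "S \<le> B"
     "\<And>s. Re s \<ge> \<sigma> \<Longrightarrow> ((\<lambda>q. b q * of_real q powr (-s)) has_sum f s) Q"
    unfolding abs_dirichlet_def by blast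
  from assms(2) obtain c T where c: "((\<lambda>q. norm (c q) * q powr -\<sigma>) has_sum T) R"
     "\<And>s. Re s \<ge> \<sigma> \<Longrightarrow> ((\<lambda>q. c q * of_real q powr (-s)) has_sum f s) R"
    unfolding abs_dirichlet_def by blast
  define b' where "b' q = (if q \<in> Q then b q else 0)" for q
  define c' where "c' q = (if q \<in> R then c q else 0)" for q
  have b': "(\<lambda>q. norm (b' q) * q powr -\<sigma>) summable_on Q \<union> R"
    "\<And>s. Re s \<ge> \<sigma> \<Longrightarrow> ((\<lambda>q. b' q * of_real q powr (-s)) has_sum f s) (Q \<union> R)"
  proof -
    show "(\<lambda>q. norm (b' q) * q powr -\<sigma>) summable_on Q \<union> R"
      using has_sum_imp_summable[OF b(1)]
      by (rule summable_on_cong_neutral[THEN iffD1, rotated -1]) (auto simp: b'_def)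
    show "((\<lambda>q. b' q * of_real q powr (-s)) has_sum f s) (Q \<union> R)" if "Re s \<ge> \<sigma>" for s
      using b(3)[OF that]
      by (rule has_sum_cong_neutral[THEN iffD1, rotated -1]) (auto simp: b'_def)
  qed
  have c': "(\<lambda>q. norm (c' q) * q powr -\<sigma>) summable_on Q \<union> R"
    "\<And>s. Re s \<ge> \<sigma> \<Longrightarrow> ((\<lambda>q. c' q * of_real q powr (-s)) has_sum f s) (Q \<union> R)"
  proof -
    show "(\<lambda>q. norm (c' q) * q powr -\<sigma>) summable_on Q \<union> R"
      using has_sum_imp_summable[OF c(1)]
      by (rule summable_on_cong_neutral[THEN iffD1, rotated -1]) (auto simp: c'_def)
    show "((\<lambda>q. c' q * of_real q powr (-s)) has_sum f s) (Q \<union> R)" if "Re s \<ge> \<sigma>" for s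
      using c(2)[OF that]
      by (rule has_sum_cong_neutral[THEN iffD1, rotated -1]) (auto simp: c'_def)
  qed
  have "b' r - c' r = 0" if "r \<in> Q \<union> R" for r
  proof (rule dirichlet_coefficients_zero[where \<sigma> = \<sigma> and Q = "Q \<union> R"])
    show "(\<lambda>q. norm (b' q - c' q) * q powr -\<sigma>) summable_on Q \<union> R"
    proof (rule summable_on_comparison_test[OF summable_on_add[OF b'(1) c'(1)]])
      show "norm (b' q - c' q) * q powr -\<sigma> \<le> norm (b' q) * q powr -\<sigma> + norm (c' q) * q powr -\<sigma>" for q
        using mult_right_mono[OF norm_triangle_ineq4[of "b' q" "c' q"], of "q powr -\<sigma>"]
        by (simp add: algebra_simps)
    qed auto
    show "((\<lambda>q. (b' q - c' q) * of_real q powr (-s)) has_sum 0) (Q \<union> R)" if "Re s = \<sigma>" for s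
      using has_sum_add[OF b'(2) has_sum_cmult_right[OF c'(2), of _ "-1"], of s s] that by (simp add: algebra_simps)
  qed (use assms that in auto)
  then have vanish: "b q = 0" if "q \<in> Q - R" for q
    using that by (force simp: b'_def c'_def)
  have "((\<lambda>q. norm (b q) * q powr -\<sigma>) has_sum S) (Q \<inter> R)"
    using b(1) by (rule has_sum_cong_neutral[THEN iffD1, rotated -1]) (use vanish in auto)
  moreover have "((\<lambda>q. b q * of_real q powr (-s)) has_sum f s) (Q \<inter> R)" if "Re s \<ge> \<sigma>" for s
    using b(3)[OF that] by (rule has_sum_cong_neutral[THEN iffD1, rotated -1]) (use vanish in auto)
  ultimately show ?thesis unfolding abs_dirichlet_def using b(2) by blast
qed

text \<open>With a gap above 1, moving the line to the right by \<tau> multiplies each term by at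
  most \<open>(1 + \<delta>) powr -\<tau>\<close>, which tends to 0.\<close>

lemma abs_dirichlet_shrink:
  assumes "abs_dirichlet Q \<sigma>0 B h" "Q \<subseteq> {1 + \<delta>..}" "\<delta> > 0" "\<epsilon> > 0"
  obtains \<sigma> where "\<sigma> \<ge> \<sigma>0" "abs_dirichlet Q \<sigma> \<epsilon> h"
proof -
  from assms(1) obtain b S where b: "((\<lambda>q. norm (b q) * q powr -\<sigma>0) has_sum S) Q"
     "\<And>s. Re s \<ge> \<sigma>0 \<Longrightarrow> ((\<lambda>q. b q * of_real q powr (-s)) has_sum h s) Q"
    unfolding abs_dirichlet_def by blast
  have "((\<lambda>\<tau>. (1 + \<delta>) powr -\<tau> * S) \<longlongrightarrow> 0) at_top" using \<open>\<delta> > 0\<close> by real_asymp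
  then have "eventually (\<lambda>\<tau>. (1 + \<delta>) powr -\<tau> * S < \<epsilon>) at_top"
    using \<open>\<epsilon> > 0\<close> order_tendstoD(2) by blast
  then have "eventually (\<lambda>\<tau>. \<tau> \<ge> 0 \<and> (1 + \<delta>) powr -\<tau> * S < \<epsilon>) at_top"
    using eventually_ge_at_top[of 0] by eventually_elim auto
  then obtain \<tau> where \<tau>: "\<tau> \<ge> 0" "(1 + \<delta>) powr -\<tau> * S < \<epsilon>"
    using eventually_happens'[OF trivial_limit_at_top_linorder] by blast
  let ?\<sigma> = "\<sigma>0 + \<tau>"
  have le: "norm (b q) * q powr -?\<sigma> \<le> (1 + \<delta>) powr -\<tau> * (norm (b q) * q powr -\<sigma>0)" if "q \<in> Q" for q
  proof -
    have "q \<ge> 1 + \<delta>" using that assms by auto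
    then have "q powr -\<tau> \<le> (1 + \<delta>) powr -\<tau>"
      using \<tau> assms by (intro powr_mono2') auto
    moreover have "q powr -?\<sigma> = q powr -\<tau> * q powr -\<sigma>0"
      by (simp add: powr_add[symmetric] add.commute)
    ultimately show ?thesis
      using mult_right_mono[of "q powr -\<tau>" "(1 + \<delta>) powr -\<tau>" "norm (b q) * q powr -\<sigma>0"]
      by (simp add: mult_ac)
  qed
  have dom: "((\<lambda>q. (1 + \<delta>) powr -\<tau> * (norm (b q) * q powr -\<sigma>0)) has_sum (1 + \<delta>) powr -\<tau> * S) Q"
    using b(1) by (rule has_sum_cmult_right)
  have sm: "(\<lambda>q. norm (b q) * q powr -?\<sigma>) summable_on Q"
    by (rule summable_on_comparison_test[OF has_sum_imp_summable[OF dom] le]) auto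
  have "infsum (\<lambda>q. norm (b q) * q powr -?\<sigma>) Q \<le> (1 + \<delta>) powr -\<tau> * S"
    using infsum_mono[OF sm has_sum_imp_summable[OF dom] le] dom by (simp add: infsumI)
  then have "abs_dirichlet Q ?\<sigma> \<epsilon> h"
    unfolding abs_dirichlet_def using \<tau> has_sum_infsum[OF sm] b(2)
    by (intro exI[of _ b] exI[of _ "infsum (\<lambda>q. norm (b q) * q powr -?\<sigma>) Q"]) auto
  then show ?thesis using that[of ?\<sigma>] \<tau> by simp
qed

section \<open>Exponentials and logarithms of absolutely convergent series\<close>

lemma abs_dirichlet_exp:
  assumes "abs_dirichlet Q \<sigma> B f" "frequency_monoid Q"
  shows "abs_dirichlet Q \<sigma> (exp B) (\<lambda>s. exp (f s))"
proof -
  have "(\<lambda>k. norm (1 / fact k :: complex) * B ^ k) = (\<lambda>k. B ^ k /\<^sub>R fact k)"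
    by (auto simp: field_simps norm_divide)
  moreover have "(\<lambda>k. B ^ k /\<^sub>R fact k) sums exp B"
    by (rule exp_converges)
  moreover have "abs_dirichlet Q \<sigma> (\<Sum>k. norm (1 / fact k :: complex) * B ^ k) (\<lambda>s. exp (f s))"
  proof (rule abs_dirichlet_power_series[OF assms])
    show "(\<lambda>k. 1 / fact k * f s ^ k) sums exp (f s)" for s
      using exp_converges[of "f s"] by (simp add: scaleR_conv_of_real field_simps)
  qed (use calculation in \<open>auto simp: sums_iff\<close>)
  ultimately show ?thesis by (simp add: sums_iff)
qed

lemma abs_dirichlet_Ln:
  assumes "abs_dirichlet Q \<sigma> (1/2) h" "frequency_monoid Q"
  shows "\<exists>B. abs_dirichlet Q \<sigma> B (\<lambda>s. Ln (1 + h s))"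
proof
  \<comment> \<open>The coefficient at \<open>k = 0\<close> is a division by zero and hence 0, in
    agreement with the missing constant term of the logarithm series.\<close>
  show "abs_dirichlet Q \<sigma> (\<Sum>k. norm (- ((-1) ^ k) / of_nat k :: complex) * (1/2) ^ k) (\<lambda>s. Ln (1 + h s))"
  proof (rule abs_dirichlet_power_series[OF assms])
    show "summable (\<lambda>k. norm (- ((-1) ^ k) / of_nat k :: complex) * (1/2) ^ k)"
    proof (rule summable_comparison_test')
      show "summable (\<lambda>k. (1/2::real) ^ k)" by (rule summable_geometric) auto
      show "norm (norm (- ((-1) ^ k) / of_nat k :: complex) * (1/2) ^ k) \<le> (1/2) ^ k" if "k \<ge> 0" for k
        by (cases "k = 0") (auto simp: norm_divide norm_power divide_simps)
    qed
    fix s assume "Re s \<ge> \<sigma>"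
    then have "norm (h s) < 1"
      using abs_dirichlet_bound[OF assms(1), of s] assms(2) by (auto simp: frequency_monoid_def)
    from Ln_series'[OF this]
    show "(\<lambda>k. - ((-1) ^ k) / of_nat k * h s ^ k) sums Ln (1 + h s)"
      by (simp add: power_minus[of "h s"])
  qed
qed

text \<open>Two values of \<open>u\<close> differ by a multiple of 2 * pi * \<i>, so the range is
  discrete. This turns identities between exponentials into identities between logarithms.\<close>

lemma constant_exp_imp_constant:
  fixes u :: "'a::topological_space \<Rightarrow> complex"
  assumes "connected S" "continuous_on S u" "\<And>s. s \<in> S \<Longrightarrow> exp (u s) = c" "x \<in> S" "y \<in> S"
  shows "u x = u y"
proof -
  have "u constant_on S"
  proof (rule continuous_discrete_range_constant[OF assms(1,2)])
    fix x assume x: "x \<in> S"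
    show "\<exists>e>0. \<forall>y. y \<in> S \<and> u y \<noteq> u x \<longrightarrow> e \<le> norm (u y - u x)"
    proof (intro exI[of _ "2 * pi"] conjI allI impI)
      fix y assume y: "y \<in> S \<and> u y \<noteq> u x"
      then have "exp (u y) = exp (u x)" using assms(3) x by simp
      then obtain n :: int where n: "u y = u x + of_int (2 * n) * of_real pi * \<i>"
        by (auto simp: exp_eq)
      then have "n \<noteq> 0" using y by auto
      then have "\<bar>real_of_int n\<bar> \<ge> 1" by linarith
      then show "2 * pi \<le> norm (u y - u x)"
        using n by (simp add: norm_mult abs_mult)
    qed auto
  qed
  then show ?thesis using assms by (auto simp: constant_on_def)
qed

section \<open>Rational frequencies\<close>

text \<open>
  Dividing an ordinary Dirichlet series by its leading term \<open>a * m powr (-s)\<close> leaves frequencies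
  \<open>ln q\<close> whose \<open>q\<close> has a power of \<open>m\<close> as denominator; \<open>power_denom 1\<close> are the frequencies of
  ordinary Dirichlet series.
\<close>

definition power_denom :: "nat \<Rightarrow> real set" where
  "power_denom n = {x. x \<ge> 1 \<and> (\<exists>j. x * real n ^ j \<in> \<nat>)}"

lemma power_denom_subset: "power_denom n \<subseteq> {1..}"
  by (auto simp: power_denom_def)

lemma power_denom_1: "power_denom 1 = \<nat> \<inter> {1..}"
  by (auto simp: power_denom_def)

lemmas power_denom_Suc_0 = power_denom_1[unfolded One_nat_def]

lemma frequency_monoid_power_denom: "frequency_monoid (power_denom n)"
  unfolding frequency_monoid_def
proof (intro conjI ballI)
  show "1 \<in> power_denom n" unfolding power_denom_def by (auto intro!: exI[of _ 0])
  fix x y assume "x \<in> power_denom n" "y \<in> power_denom n"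
  then obtain j k where *: "x \<ge> 1" "y \<ge> 1" "x * real n ^ j \<in> \<nat>" "y * real n ^ k \<in> \<nat>"
    unfolding power_denom_def by blast
  have "(x * real n ^ j) * (y * real n ^ k) \<in> \<nat>" using *(3,4) by (rule Nats_mult)
  then have "x * y * real n ^ (j + k) \<in> \<nat>" by (simp add: power_add mult_ac)
  moreover have "x * y \<ge> 1" using mult_mono[of 1 x 1 y] * by simp
  ultimately show "x * y \<in> power_denom n" unfolding power_denom_def by blast
qed (rule power_denom_subset)

lemma power_denom_power: "power_denom (n ^ c) \<subseteq> power_denom n"
  unfolding power_denom_def by (auto simp: power_mult[symmetric])

lemma power_denom_1_subset: "power_denom 1 \<subseteq> power_denom n"
  unfolding power_denom_1 by (auto simp: power_denom_def intro!: exI[of _ 0])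

text \<open>Writing x = a / m ^ j = b / n ^ k and clearing denominators gives a * n ^ k = b * m ^ j,
  and coprimality makes m ^ j divide a.\<close>

lemma power_denom_coprime_Int:
  assumes "coprime m n" "m \<ge> 1" "n \<ge> 1"
  shows "power_denom m \<inter> power_denom n = power_denom 1"
proof
  show "power_denom m \<inter> power_denom n \<subseteq> power_denom 1"
  proof
    fix x assume "x \<in> power_denom m \<inter> power_denom n"
    then obtain j k a b where x: "x \<ge> 1" "x * real m ^ j = real a" "x * real n ^ k = real b"
      unfolding power_denom_def by (force elim!: Nats_cases)
    have "real (a * n ^ k) = real (b * m ^ j)"
      using x(2,3) by (simp flip: x(2,3))
    then have "a * n ^ k = b * m ^ j" by linarith
    moreover have "coprime (m ^ j) (n ^ k)" using assms by simp
    ultimately have "m ^ j dvd a"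
      by (metis coprime_dvd_mult_left_iff dvd_triv_right)
    then obtain d where "a = m ^ j * d" by blast
    then have "x = real d" using x(2) assms by simp
    then show "x \<in> power_denom 1" unfolding power_denom_1 using x by auto
  qed
qed (use power_denom_1_subset in blast)

text \<open>At \<theta> + 1 the terms tend to 0, so they are bounded; the exponent \<theta> + 3
  leaves a further factor \<open>real (Suc k) powr -2\<close>, which is summable.\<close>

lemma dirichlet_series_abs_summable:
  assumes "has_dirichlet_series f a (half_plane \<theta>)"
  shows "summable (\<lambda>k. norm (a (Suc k)) * real (Suc k) powr -(\<theta> + 3))"
proof -
  have conv: "(\<lambda>k. a (Suc k) * of_nat (Suc k) powr (- s)) sums f s" if "Re s > \<theta>" for s
    using assms that unfolding has_dirichlet_series_def half_plane_def by auto
  have "(\<lambda>k. a (Suc k) * of_nat (Suc k) powr (- of_real (\<theta> + 1))) \<longlonglongrightarrow> 0"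
    using conv[of "of_real (\<theta> + 1)"] by (intro summable_LIMSEQ_zero) (auto simp: sums_iff)
  then have "Bseq (\<lambda>k. a (Suc k) * of_nat (Suc k) powr (- of_real (\<theta> + 1)))"
    by (rule convergentI[THEN convergent_imp_Bseq])
  then obtain K where K: "K > 0" "\<And>k. norm (a (Suc k) * of_nat (Suc k) powr (- of_real (\<theta> + 1))) \<le> K"
    unfolding Bseq_def by blast
  let ?n = "\<lambda>k. norm (a (Suc k)) * real (Suc k) powr -(\<theta> + 3)"
  show ?thesis
  proof (rule summable_comparison_test')
    show "summable (\<lambda>k. K * real (Suc k) powr -2)"
      by (intro summable_mult) (subst summable_Suc_iff[of "\<lambda>k. real k powr -2"], simp add: summable_real_powr_iff)
    show "norm (?n k) \<le> K * real (Suc k) powr -2" if "k \<ge> 0" for k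
    proof -
      have "?n k = norm (a (Suc k)) * real (Suc k) powr -(\<theta> + 1) * real (Suc k) powr -2"
        by (simp add: powr_add[symmetric] mult.assoc add.commute)
      moreover have "norm (a (Suc k)) * real (Suc k) powr -(\<theta> + 1) \<le> K"
        using K(2)[of k] norm_dirichlet_term[of "real (Suc k)" "a (Suc k)" "of_real (\<theta> + 1)"]
        by (simp del: of_nat_Suc)
      ultimately have "?n k \<le> K * real (Suc k) powr -2" by (simp only: mult_right_mono powr_ge_zero)
      then show ?thesis by (simp only: real_norm_def abs_mult abs_norm_cancel abs_of_nonneg powr_ge_zero)
    qed
  qed
qed

lemma dirichlet_series_abs_dirichlet:
  assumes "has_dirichlet_series f a (half_plane \<theta>)"
  shows "\<exists>B. abs_dirichlet (power_denom 1) (\<theta> + 3) B f"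
proof -
  have conv: "(\<lambda>k. a (Suc k) * of_nat (Suc k) powr (- s)) sums f s" if "Re s > \<theta>" for s
    using assms that unfolding has_dirichlet_series_def half_plane_def by auto
  let ?n = "\<lambda>k. norm (a (Suc k)) * real (Suc k) powr -(\<theta> + 3)"
  have n: "(?n has_sum suminf ?n) UNIV"
    using dirichlet_series_abs_summable[OF assms] by (intro sums_nonneg_imp_has_sum summable_sums) auto
  have "abs_dirichlet (power_denom 1) (\<theta> + 3) (suminf ?n) f"
  proof (rule abs_dirichlet_regroup[where c = "\<lambda>k. a (Suc k)" and q = "\<lambda>k. real (Suc k)" and I = UNIV])
    fix s assume s: "Re s \<ge> \<theta> + 3"
    have "(\<lambda>k. norm (a (Suc k) * of_real (real (Suc k)) powr (-s))) summable_on UNIV"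
      by (rule dirichlet_terms_summable[OF has_sum_imp_summable[OF n]]) (use s in auto)
    then have "summable (\<lambda>k. norm (a (Suc k) * of_real (real (Suc k)) powr (-s)))"
      by (rule summable_on_imp_summable)
    then show "((\<lambda>k. a (Suc k) * of_real (real (Suc k)) powr (-s)) has_sum f s) UNIV"
      by (rule norm_summable_imp_has_sum) (use conv[of s] s in \<open>auto simp del: of_nat_Suc\<close>)
  qed (use n power_denom_subset in \<open>auto simp: power_denom_Suc_0 simp del: of_nat_Suc\<close>)
  then show ?thesis by blast
qed

lemma abs_dirichlet_dirichlet_series:
  assumes "abs_dirichlet (power_denom 1) \<sigma> B f"
  obtains a where "summable (\<lambda>k. norm (a (Suc k)) * real (Suc k) powr -\<sigma>)"
    "\<And>s. Re s \<ge> \<sigma> \<Longrightarrow> (\<lambda>k. a (Suc k) * of_nat (Suc k) powr (- s)) sums f s"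
proof -
  from assms obtain b S where b: "((\<lambda>q. norm (b q) * q powr -\<sigma>) has_sum S) (power_denom 1)"
     "\<And>s. Re s \<ge> \<sigma> \<Longrightarrow> ((\<lambda>q. b q * of_real q powr (-s)) has_sum f s) (power_denom 1)"
    unfolding abs_dirichlet_def by blast
  have bij: "bij_betw (\<lambda>k. real (Suc k)) UNIV (power_denom 1)"
    unfolding bij_betw_def power_denom_1
  proof
    show "range (\<lambda>k. real (Suc k)) = \<nat> \<inter> {1..}"
    proof
      show "\<nat> \<inter> {1..} \<subseteq> range (\<lambda>k. real (Suc k))"
      proof
        fix x :: real assume "x \<in> \<nat> \<inter> {1..}"
        then obtain n where "x = real n" "n \<ge> 1" by (auto elim!: Nats_cases)
        then show "x \<in> range (\<lambda>k. real (Suc k))" by (intro image_eqI[of _ _ "n - 1"]) auto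
      qed
    qed (auto simp del: of_nat_Suc)
  qed (auto simp: inj_on_def)
  show ?thesis
  proof (rule that[of "\<lambda>n. b (real n)"])
    show "summable (\<lambda>k. norm (b (real (Suc k))) * real (Suc k) powr -\<sigma>)"
      using has_sum_reindex_bij_betw[OF bij, of "\<lambda>q. norm (b q) * q powr -\<sigma>" S] b(1)
        has_sum_imp_sums sums_summable by blast
    show "(\<lambda>k. b (real (Suc k)) * of_nat (Suc k) powr (- s)) sums f s" if "Re s \<ge> \<sigma>" for s
      using has_sum_imp_sums[OF has_sum_reindex_bij_betw[OF bij, of "\<lambda>q. b q * of_real q powr (-s)" "f s", THEN iffD2, OF b(2)[OF that]]]
      by (simp del: of_nat_Suc)
  qed
qed

text \<open>A nonzero value of \<open>F\<close> guarantees a least \<open>m\<close> with nonzero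
  coefficient. The other integers that occur are at least m + 1, so after division by the leading
  term the frequencies start at 1 + 1 / m, and this gap makes \<open>h\<close> small far to the
  right.\<close>

lemma abs_dirichlet_leading_term:
  assumes "abs_dirichlet (power_denom 1) \<sigma>0 B F" "F s0 \<noteq> 0" "Re s0 \<ge> \<sigma>0" "\<epsilon> > 0"
  obtains m a \<sigma> h where "m \<ge> 1" "a \<noteq> 0" "\<sigma> \<ge> \<sigma>0" "abs_dirichlet (power_denom m) \<sigma> \<epsilon> h"
    "\<And>s. Re s \<ge> \<sigma> \<Longrightarrow> F s = a * of_nat m powr (-s) * (1 + h s)"
proof -
  let ?N = "power_denom 1"
  from assms obtain b S where b: "((\<lambda>q. norm (b q) * q powr -\<sigma>0) has_sum S) ?N"
     "\<And>s. Re s \<ge> \<sigma>0 \<Longrightarrow> ((\<lambda>q. b q * of_real q powr (-s)) has_sum F s) ?N"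
    unfolding abs_dirichlet_def by blast
  have "\<exists>m\<ge>1. b (real m) \<noteq> 0"
  proof (rule ccontr)
    assume "\<not> ?thesis"
    then have "b q = 0" if "q \<in> ?N" for q using that by (auto simp: power_denom_Suc_0 elim!: Nats_cases)
    then have "((\<lambda>q. b q * of_real q powr (-s0)) has_sum 0) ?N" by (intro has_sum_0) auto
    with b(2)[of s0] assms(2,3) show False using has_sum_unique by blast
  qed
  define m where "m = (LEAST m. m \<ge> 1 \<and> b (real m) \<noteq> 0)"
  have m: "m \<ge> 1" "b (real m) \<noteq> 0"
    using LeastI_ex[OF \<open>\<exists>m\<ge>1. b (real m) \<noteq> 0\<close>] by (auto simp: m_def)
  have least: "b (real k) = 0" if "k \<ge> 1" "k < m" for k
    using not_less_Least[of k "\<lambda>m. m \<ge> 1 \<and> b (real m) \<noteq> 0"] that by (auto simp: m_def)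
  define a where "a = b (real m)"
  define K where "K = \<nat> \<inter> {real m + 1..}"
  define c where "c q = b q / a" for q
  \<comment> \<open>Defined by the desired factorisation, which then holds for every
    \<open>s\<close>; what remains is the expansion of \<open>h\<close>.\<close>
  define h where "h s = F s * of_nat m powr s / a - 1" for s
  have KN: "K \<subseteq> ?N" "real m \<notin> K" "real m \<in> ?N" using m by (auto simp: K_def power_denom_Suc_0)
  have zero: "b q = 0" if q: "q \<in> ?N - insert (real m) K" for q
  proof -
    obtain k where k: "q = real k" "k \<ge> 1" using q by (auto simp: power_denom_Suc_0 elim!: Nats_cases)
    with q have "k < m" by (force simp: K_def)
    then show ?thesis using least k by auto
  qed
  have split: "((\<lambda>q. b q * of_real q powr (-s)) has_sum (F s - a * of_nat m powr (-s))) K"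
    if "Re s \<ge> \<sigma>0" for s
  proof -
    have "((\<lambda>q. b q * of_real q powr (-s)) has_sum F s) (insert (real m) K)"
      using b(2)[OF that] KN by (subst has_sum_cong_neutral[where T = ?N]) (auto simp: zero)
    from has_sum_Diff[OF this has_sum_finite[of "{real m}"]] show ?thesis
      using KN by (simp add: a_def)
  qed
  define K' where "K' = (\<lambda>q. q / real m) ` K"
  have quot: "complex_of_real q powr (-s) * of_nat m powr s = of_real (q / real m) powr (-s)" if "q \<in> K" for q s
  proof -
    have "q > 0" using that by (auto simp: K_def)
    then have "of_real (q / real m * real m) powr (-s) = of_real (q / real m) powr (-s) * of_real (real m) powr (-s)"
      using m by (subst of_real_mult, subst powr_times_real) auto
    then have "of_real q powr (-s) = of_real (q / real m) powr (-s) * of_real (real m) powr (-s)"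
      using m by simp
    moreover have "complex_of_nat m powr (-s) * of_nat m powr s = 1"
      using m by (simp add: powr_minus)
    ultimately show ?thesis by simp
  qed
  have norms: "(\<lambda>q. norm (c q) * (q / real m) powr -\<sigma>0) summable_on K"
  proof -
    have "(\<lambda>q. norm (b q) * q powr -\<sigma>0) summable_on K"
      by (rule summable_on_subset_banach[OF has_sum_imp_summable[OF b(1)] KN(1)])
    then have "(\<lambda>q. norm (b q) * q powr -\<sigma>0 * (real m powr \<sigma>0 / norm a)) summable_on K"
      by (rule summable_on_cmult_left)
    moreover have "norm (b q) * q powr -\<sigma>0 * (real m powr \<sigma>0 / norm a) = norm (c q) * (q / real m) powr -\<sigma>0"
      if "q \<in> K" for q
      using that m by (auto simp: c_def norm_divide powr_divide powr_minus K_def field_simps)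
    ultimately show ?thesis by (simp cong: summable_on_cong)
  qed
  have "abs_dirichlet K' \<sigma>0 (infsum (\<lambda>q. norm (c q) * (q / real m) powr -\<sigma>0) K) h"
  proof (rule abs_dirichlet_regroup[OF has_sum_infsum[OF norms]])
    show "K' \<subseteq> {1..}" unfolding K'_def K_def using m by (auto simp: field_simps)
    fix s assume s: "Re s \<ge> \<sigma>0"
    have "((\<lambda>q. b q * of_real q powr (-s) * (of_nat m powr s / a)) has_sum
        (F s - a * of_nat m powr (-s)) * (of_nat m powr s / a)) K"
      using split[OF s] by (rule has_sum_cmult_left)
    moreover have "b q * of_real q powr (-s) * (of_nat m powr s / a) = c q * of_real (q / real m) powr (-s)"
      if "q \<in> K" for q
      using quot[OF that, of s, symmetric] by (simp add: c_def)
    moreover have "(F s - a * of_nat m powr (-s)) * (of_nat m powr s / a) = h s"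
      using m by (simp add: h_def a_def powr_minus field_simps)
    ultimately show "((\<lambda>q. c q * of_real (q / real m) powr (-s)) has_sum h s) K"
      by (metis (no_types, lifting) has_sum_cong)
  qed (auto simp: K'_def)
  moreover have "K' \<subseteq> {1 + 1 / real m..}"
    using m divide_right_mono[of "real m + 1" _ "real m"] by (auto simp: K'_def K_def add_divide_distrib)
  moreover have "1 / real m > 0" using m by simp
  ultimately obtain \<sigma> where \<sigma>: "\<sigma> \<ge> \<sigma>0" "abs_dirichlet K' \<sigma> \<epsilon> h"
    using abs_dirichlet_shrink \<open>\<epsilon> > 0\<close> by blast
  have "K' \<subseteq> power_denom m"
    unfolding K'_def K_def power_denom_def using m by (auto simp: field_simps intro!: exI[of _ 1])
  then have "abs_dirichlet (power_denom m) \<sigma> \<epsilon> h"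
    using abs_dirichlet_mono[OF \<sigma>(2)] power_denom_subset by blast
  moreover have "F s = a * of_nat m powr (-s) * (1 + h s)" for s
    using m by (simp add: h_def a_def powr_minus field_simps)
  ultimately show ?thesis using that m \<sigma> by (metis a_def)
qed

text \<open>\<open>b1\<close> is the coefficient at frequency 1. The other frequencies are at least
  2, so there is a gap, and \<open>F\<close> tends to \<open>b1\<close> as \<open>Re s\<close>
  grows.\<close>

lemma abs_dirichlet_constant_term:
  assumes "abs_dirichlet (power_denom 1) \<sigma>0 B F"
  obtains b1 where "\<And>\<epsilon>. \<epsilon> > 0 \<Longrightarrow> \<exists>\<sigma>\<ge>\<sigma>0. abs_dirichlet (power_denom 1) \<sigma> \<epsilon> (\<lambda>s. F s - b1)"
proof -
  let ?N = "power_denom 1"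
  from assms obtain b S where b: "((\<lambda>q. norm (b q) * q powr -\<sigma>0) has_sum S) ?N"
     "\<And>s. Re s \<ge> \<sigma>0 \<Longrightarrow> ((\<lambda>q. b q * of_real q powr (-s)) has_sum F s) ?N"
    unfolding abs_dirichlet_def by blast
  define K where "K = ?N - {1}"
  have KN: "1 \<in> ?N" by (auto simp: power_denom_Suc_0)
  have K2: "K \<subseteq> {1 + 1..}"
    by (auto simp: K_def power_denom_Suc_0 elim!: Nats_cases)
  have n: "(\<lambda>q. norm (b q) * q powr -\<sigma>0) summable_on K"
    by (rule summable_on_subset_banach[OF has_sum_imp_summable[OF b(1)]]) (auto simp: K_def)
  have "((\<lambda>q. b q * of_real q powr (-s)) has_sum (F s - b 1)) K" if "Re s \<ge> \<sigma>0" for s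
    using has_sum_Diff[OF b(2)[OF that] has_sum_finite[of "{1}"]] KN by (simp add: K_def)
  then have K: "abs_dirichlet K \<sigma>0 (infsum (\<lambda>q. norm (b q) * q powr -\<sigma>0) K) (\<lambda>s. F s - b 1)"
    unfolding abs_dirichlet_def using has_sum_infsum[OF n] by blast
  show ?thesis
  proof (rule that)
    fix \<epsilon> :: real assume "\<epsilon> > 0"
    then obtain \<sigma> where \<sigma>: "\<sigma> \<ge> \<sigma>0" "abs_dirichlet K \<sigma> \<epsilon> (\<lambda>s. F s - b 1)"
      using abs_dirichlet_shrink[OF K K2] by (metis zero_less_one)
    then show "\<exists>\<sigma>\<ge>\<sigma>0. abs_dirichlet ?N \<sigma> \<epsilon> (\<lambda>s. F s - b 1)"
      using abs_dirichlet_mono[OF \<sigma>(2)] power_denom_subset[of 1] by (auto simp: K_def)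
  qed
qed

section \<open>Logarithms of Dirichlet series\<close>

definition forward_difference :: "(real \<Rightarrow> real) \<Rightarrow> real \<Rightarrow> real" where
  "forward_difference f x = f (x + 1) - f x"

lemma forward_difference_pow_Ints:
  assumes "\<And>n::nat. n \<ge> 1 \<Longrightarrow> f (real n) \<in> \<int>" "n \<ge> 1"
  shows "(forward_difference ^^ k) f (real n) \<in> \<int>"
  using assms(2)
proof (induction k arbitrary: n)
  case 0
  then show ?case using assms(1) by simp
next
  case (Suc k)
  from Suc.IH[of n] Suc.IH[of "Suc n"] Suc.prems show ?case
    by (simp add: forward_difference_def[of "(forward_difference ^^ k) f"] add.commute Ints_diff)
qed

text \<open>\<open>D\<close> lists a function and its successive derivatives. Generality in
  \<open>D\<close> drives the induction: differencing the whole list gives a list of the same kind,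
  and one more mean value theorem turns the last difference into the next derivative.\<close>

lemma forward_difference_pow_mean_value:
  assumes "\<And>j x. x > 0 \<Longrightarrow> (D j has_real_derivative D (Suc j) x) (at x)" "x > 0"
  shows "\<exists>\<xi>\<ge>x. (forward_difference ^^ k) (D 0) x = D k \<xi>"
  using assms
proof (induction k arbitrary: D)
  case 0
  then show ?case by auto
next
  case (Suc k)
  have "\<exists>\<xi>\<ge>x. (forward_difference ^^ k) (forward_difference (D 0)) x = forward_difference (D k) \<xi>"
  proof (rule Suc.IH)
    fix j y assume "y > (0::real)"
    then show "(forward_difference (D j) has_real_derivative forward_difference (D (Suc j)) y) (at y)"
      unfolding forward_difference_def[abs_def]
      by (intro DERIV_diff Suc.prems(1) DERIV_shift[THEN iffD1]) auto
  qed (rule Suc.prems(2))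
  then obtain \<xi> where \<xi>: "\<xi> \<ge> x" "(forward_difference ^^ k) (forward_difference (D 0)) x = forward_difference (D k) \<xi>"
    by blast
  have "\<exists>z>\<xi>. z < \<xi> + 1 \<and> D k (\<xi> + 1) - D k \<xi> = (\<xi> + 1 - \<xi>) * D (Suc k) z"
    using Suc.prems \<xi>(1) by (intro MVT2) auto
  then obtain z where "z > \<xi>" "D k (\<xi> + 1) - D k \<xi> = D (Suc k) z" by auto
  then show ?case
    using \<xi> by (intro exI[of _ z]) (simp add: funpow_Suc_right forward_difference_def[of "D k"] del: funpow.simps)
qed

text \<open>
  If \<open>c\<close> is not an integer, a difference of order \<open>k > c\<close> of \<open>x powr c\<close> is nonzero but
  tends to \<open>0\<close>, which is impossible for an integer sequence.
\<close>

lemma powr_integer_imp_Nats: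
  fixes c :: real
  assumes "\<And>n::nat. n \<ge> 1 \<Longrightarrow> real n powr c \<in> \<int>" "c \<ge> 0"
  shows "c \<in> \<nat>"
proof (rule ccontr)
  assume c: "c \<notin> \<nat>"
  \<comment> \<open>The least natural number above \<open>c\<close>, so that
    \<open>x powr (c - real k)\<close> tends to 0.\<close>
  define k where "k = nat \<lfloor>c\<rfloor> + 1"
  have "c < real k" using assms(2) by (simp add: k_def) linarith
  \<comment> \<open>The falling factorial, which is the coefficient of the \<open>j\<close>-th
    derivative of \<open>x powr c\<close>; none of its factors vanishes if \<open>c\<close> is not a
    natural number.\<close>
  define C where "C j = (\<Prod>i<j. c - real i)" for j
  define D where "D j x = C j * x powr (c - real j)" for j x
  have D: "(D j has_real_derivative D (Suc j) x) (at x)" if "x > 0" for j x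
    unfolding D_def using that
    by (auto intro!: derivative_eq_intros simp: C_def algebra_simps)
  have C0: "C k \<noteq> 0" unfolding C_def using c by (auto simp: Nats_def)
  have "((\<lambda>x. \<bar>C k\<bar> * x powr (c - real k)) \<longlongrightarrow> 0) at_top"
    using \<open>c < real k\<close> by (intro tendsto_mult_right_zero tendsto_neg_powr filterlim_ident) auto
  then have "eventually (\<lambda>x. \<bar>C k\<bar> * x powr (c - real k) < 1) at_top"
    using order_tendstoD(2) zero_less_one by blast
  then obtain X where X: "\<And>x. x \<ge> X \<Longrightarrow> \<bar>C k\<bar> * x powr (c - real k) < 1"
    by (auto simp: eventually_at_top_linorder)
  define n where "n = nat \<lceil>max 1 X\<rceil>"
  have n: "n \<ge> 1" "real n \<ge> X" unfolding n_def by linarith+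
  obtain \<xi> where \<xi>: "\<xi> \<ge> real n" "(forward_difference ^^ k) (D 0) (real n) = D k \<xi>"
    using forward_difference_pow_mean_value[where D = D, OF D, of "real n" k] n by auto
  have "D 0 = (\<lambda>x. x powr c)" by (auto simp: D_def C_def)
  then have "D k \<xi> \<in> \<int>"
    using forward_difference_pow_Ints[of "D 0" n k] assms(1) n \<xi> by simp
  moreover have "D k \<xi> \<noteq> 0" using C0 \<xi>(1) n by (auto simp: D_def)
  moreover have "\<bar>D k \<xi>\<bar> < 1" using X[of \<xi>] \<xi> n by (simp add: D_def abs_mult)
  ultimately show False using Ints_nonzero_abs_less1 by blast
qed

section \<open>Expansion of \<Phi> far to the right\<close>

lemma of_nat_powr_eq_exp:
  "n \<ge> 1 \<Longrightarrow> (of_nat n :: complex) powr s = exp (s * of_real (ln (real n)))"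
  by (simp add: powr_def Ln_of_nat)

text \<open>Far to the right \<open>1 + h\<close> stays off the negative axis, so both sides of the
  leading term factorisation have explicit continuous logarithms. The formula for \<Phi> holds for
  all \<open>s\<close> because \<psi> is defined by it; the content is the expansion of
  \<psi>.\<close>

lemma abs_dirichlet_log_expansion:
  assumes hol: "\<Phi> holomorphic_on half_plane 0" and n: "n \<ge> 2"
    and F: "nat_powr_neg n \<Phi> \<in> dirichlet_algebra"
  obtains m \<sigma> B \<psi> where "m \<ge> 1" "\<sigma> > 0" "abs_dirichlet (power_denom m) \<sigma> B \<psi>"
    "\<And>s. \<Phi> s = of_real (ln (real m) / ln (real n)) * s + \<psi> s"
proof -
  let ?F = "nat_powr_neg n \<Phi>"
  have Fexp: "?F s = exp (- \<Phi> s * of_real (ln (real n)))" for s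
    using n by (simp add: nat_powr_neg_def of_nat_powr_eq_exp)
  from F obtain a0 where "has_dirichlet_series ?F a0 (half_plane 0)"
    unfolding dirichlet_algebra_def by blast
  then obtain B0 where "abs_dirichlet (power_denom 1) (0 + 3) B0 ?F"
    using dirichlet_series_abs_dirichlet by blast
  \<comment> \<open>An exponential has no zeros, so any point where absolute convergence is secured
    would do; 3 lies on the boundary of that region.\<close>
  moreover have "?F 3 \<noteq> 0" "Re 3 \<ge> 0 + 3" "(1/2 :: real) > 0" by (simp_all add: Fexp)
  ultimately obtain m a \<sigma> h where m: "m \<ge> 1" "a \<noteq> 0" "\<sigma> \<ge> 0 + 3"
      "abs_dirichlet (power_denom m) \<sigma> (1/2) h"
    and Fh: "\<And>s. Re s \<ge> \<sigma> \<Longrightarrow> ?F s = a * of_nat m powr (-s) * (1 + h s)"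
    by (rule abs_dirichlet_leading_term) (rule that)
  have hbound: "norm (h s) \<le> 1/2" if "Re s \<ge> \<sigma>" for s
    using abs_dirichlet_bound[OF m(4) power_denom_subset that] .
  then have h1: "1 + h s \<notin> \<real>\<^sub>\<le>\<^sub>0" if "Re s \<ge> \<sigma>" for s
  proof -
    have "\<bar>Re (h s)\<bar> \<le> 1/2" using hbound[OF that] abs_Re_le_cmod order_trans by blast
    then show ?thesis by (auto simp: complex_nonpos_Reals_iff)
  qed
  define S where "S = {s. Re s \<ge> \<sigma>}"
  have "S \<subseteq> half_plane 0" using m by (auto simp: S_def half_plane_def)
  then have cont\<Phi>: "continuous_on S \<Phi>"
    using holomorphic_on_imp_continuous_on[OF hol] continuous_on_subset by blast
  have "h s = ?F s * of_nat m powr s / a - 1" if "s \<in> S" for s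
    using Fh[of s] that m by (simp add: S_def powr_minus field_simps)
  moreover have "continuous_on S (\<lambda>s. ?F s * of_nat m powr s / a - 1)"
    unfolding Fexp using m by (intro continuous_intros cont\<Phi>) auto
  ultimately have conth: "continuous_on S h" by (simp cong: continuous_on_cong)
  \<comment> \<open>The discrepancy between the two logarithms: its exponential is the constant
    \<open>a\<close>, so \<open>u\<close> is constant on the connected set \<open>S\<close>.\<close>
  define u where "u s = - \<Phi> s * of_real (ln (real n)) + s * of_real (ln (real m)) - Ln (1 + h s)" for s
  have contu: "continuous_on S u"
    unfolding u_def using h1 by (intro continuous_intros cont\<Phi> conth) (auto simp: S_def)
  have expu: "exp (u s) = a" if "s \<in> S" for s
  proof -
    have ne: "1 + h s \<noteq> 0" using h1[of s] that by (auto simp: S_def)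
    have "exp (u s) = ?F s * exp (s * of_real (ln (real m))) / (1 + h s)"
      using ne by (simp add: u_def Fexp exp_diff exp_add exp_minus divide_inverse)
    also have "exp (s * of_real (ln (real m))) = of_nat m powr s"
      using m by (simp add: of_nat_powr_eq_exp)
    also have "?F s * of_nat m powr s / (1 + h s) = a"
      using Fh[of s] that m ne by (simp add: S_def powr_minus field_simps)
    finally show ?thesis .
  qed
  have "convex S" unfolding S_def by (rule convex_halfspace_Re_ge)
  then have ueq: "u s = u (of_real \<sigma>)" if "s \<in> S" for s
    using constant_exp_imp_constant[OF convex_connected contu expu that] by (auto simp: S_def)
  define l where "l = complex_of_real (ln (real n))"
  have l: "l \<noteq> 0" using n by (simp add: l_def)
  define \<psi> where "\<psi> s = \<Phi> s - of_real (ln (real m) / ln (real n)) * s" for s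
  have \<psi>: "(- u (of_real \<sigma>) / l) + (- 1 / l) * Ln (1 + h s) = \<psi> s" if "Re s \<ge> \<sigma>" for s
  proof -
    have "u (of_real \<sigma>) = - \<Phi> s * l + s * of_real (ln (real m)) - Ln (1 + h s)"
      using ueq[of s] that by (simp add: S_def u_def[of s] l_def)
    then show ?thesis using l by (simp add: \<psi>_def l_def[symmetric] field_simps)
  qed
  obtain B1 where "abs_dirichlet (power_denom m) \<sigma> B1 (\<lambda>s. Ln (1 + h s))"
    using abs_dirichlet_Ln[OF m(4) frequency_monoid_power_denom] by blast
  then have "abs_dirichlet (power_denom m) \<sigma> (norm (- u (of_real \<sigma>) / l) + norm (- 1 / l) * B1)
      (\<lambda>s. (- u (of_real \<sigma>) / l) + (- 1 / l) * Ln (1 + h s))"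
    by (intro abs_dirichlet_add abs_dirichlet_cmult abs_dirichlet_const frequency_monoid_power_denom
        power_denom_subset order_refl)
  then have "abs_dirichlet (power_denom m) \<sigma> (norm (- u (of_real \<sigma>) / l) + norm (- 1 / l) * B1) \<psi>"
    by (rule abs_dirichlet_cong) (rule \<psi>)
  then show ?thesis
    using that[of m \<sigma> _ \<psi>] m by (auto simp: \<psi>_def)
qed

text \<open>\<psi> and \<omega> are bounded far to the right, whereas distinct slopes would make
  their difference grow linearly along the real axis. This makes the slope independent of
  \<open>n\<close>.\<close>

lemma abs_dirichlet_linear_coefficient_unique:
  assumes "abs_dirichlet Q \<sigma> B \<psi>" "abs_dirichlet R \<tau> C \<omega>" "Q \<subseteq> {1..}" "R \<subseteq> {1..}"
    and eq: "\<And>s. of_real \<alpha> * s + \<psi> s = of_real \<beta> * s + \<omega> s"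
  shows "\<alpha> = \<beta>"
proof (rule ccontr)
  assume ne: "\<alpha> \<noteq> \<beta>"
  define x where "x = max (max \<sigma> \<tau>) ((B + C + 1) / \<bar>\<alpha> - \<beta>\<bar>)"
  have "norm (\<psi> (of_real x)) \<le> B" "norm (\<omega> (of_real x)) \<le> C"
    using abs_dirichlet_bound[OF assms(1,3), of "of_real x"] abs_dirichlet_bound[OF assms(2,4), of "of_real x"]
    by (simp_all add: x_def)
  moreover have "of_real ((\<alpha> - \<beta>) * x) = \<omega> (of_real x) - \<psi> (of_real x)"
    using eq[of "of_real x"] by (simp add: algebra_simps)
  moreover have "norm (\<omega> (of_real x) - \<psi> (of_real x)) \<le> norm (\<omega> (of_real x)) + norm (\<psi> (of_real x))"
    by (rule norm_triangle_ineq4)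
  ultimately have "norm (complex_of_real ((\<alpha> - \<beta>) * x)) \<le> B + C" by simp
  then have "\<bar>\<alpha> - \<beta>\<bar> * \<bar>x\<bar> \<le> B + C" unfolding norm_of_real by (simp add: abs_mult)
  then have "\<bar>\<alpha> - \<beta>\<bar> * x \<le> B + C"
    using mult_left_mono[OF abs_ge_self[of x] abs_ge_zero[of "\<alpha> - \<beta>"]] by linarith
  moreover have "\<bar>\<alpha> - \<beta>\<bar> * x \<ge> \<bar>\<alpha> - \<beta>\<bar> * ((B + C + 1) / \<bar>\<alpha> - \<beta>\<bar>)"
    by (intro mult_left_mono) (auto simp: x_def)
  ultimately show False using ne by simp
qed

text \<open>
  The expansions of \<open>\<Phi>\<close> for \<open>n = 2\<close> and \<open>n = 3\<close> agree, so their common frequencies have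
  denominators that are powers of 2 and of 3, that is, they are logarithms of integers.
\<close>

lemma G_infinity_if_nat_powr_neg:
  assumes an: "\<Phi> analytic_on half_plane 0" and im: "\<Phi> ` half_plane 0 \<subseteq> half_plane 0"
    and alg: "\<And>n. n \<ge> 1 \<Longrightarrow> nat_powr_neg n \<Phi> \<in> dirichlet_algebra"
  shows "\<Phi> \<in> G_infinity"
proof -
  have hol: "\<Phi> holomorphic_on half_plane 0" using an by (rule analytic_imp_holomorphic)
  have "\<exists>m \<sigma> B \<psi>. m \<ge> 1 \<and> \<sigma> > 0 \<and> abs_dirichlet (power_denom m) \<sigma> B \<psi> \<and>
      (\<forall>s. \<Phi> s = of_real (ln (real m) / ln (real n)) * s + \<psi> s)" if "n \<ge> 2" for n
    using abs_dirichlet_log_expansion[OF hol that alg[of n]] that by (metis Suc_1 Suc_leD)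
  note expansion = this
  obtain m2 \<sigma>2 B2 \<psi>2 where 2: "m2 \<ge> 1" "\<sigma>2 > 0" "abs_dirichlet (power_denom m2) \<sigma>2 B2 \<psi>2"
      "\<And>s. \<Phi> s = of_real (ln (real m2) / ln 2) * s + \<psi>2 s"
    using expansion[of 2] by auto
  define c where "c = ln (real m2) / ln 2"
  have coeff: "c = ln (real m) / ln (real n)"
    if "abs_dirichlet (power_denom m) \<sigma> B \<psi>" "\<And>s. \<Phi> s = of_real (ln (real m) / ln (real n)) * s + \<psi> s"
    for m \<sigma> B \<psi> n
    by (rule abs_dirichlet_linear_coefficient_unique[OF 2(3) that(1)])
       (use power_denom_subset 2(4) that(2) in \<open>simp_all add: c_def\<close>)
  have powr: "real n powr c = real m" if "m \<ge> 1" "n \<ge> 2" "c = ln (real m) / ln (real n)" for m n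
    using that by (simp add: powr_def)
  have "c \<in> \<nat>"
  proof (rule powr_integer_imp_Nats)
    show "c \<ge> 0" using 2 by (simp add: c_def)
    fix n :: nat assume "n \<ge> 1"
    show "real n powr c \<in> \<int>"
    proof (cases "n = 1")
      case False
      then have "n \<ge> 2" using \<open>n \<ge> 1\<close> by linarith
      then obtain m where "real n powr c = real m"
        using expansion[of n] coeff powr by metis
      then show ?thesis by simp
    qed auto
  qed
  then obtain k :: nat where k: "c = real k" by (auto elim: Nats_cases)
  \<comment> \<open>With \<open>m2\<close> a power of 2, \<open>power_denom m2\<close> is contained
    in \<open>power_denom 2\<close>; likewise for 3 below.\<close>
  have m2: "m2 = 2 ^ k"
  proof -
    have "real m2 = real (2 ^ k)"
      using powr[of m2 2] 2(1) by (simp add: c_def[symmetric] k powr_realpow)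
    then show ?thesis by (simp only: of_nat_eq_iff)
  qed
  obtain m3 \<sigma>3 B3 \<psi>3 where 3: "m3 \<ge> 1" "\<sigma>3 > 0" "abs_dirichlet (power_denom m3) \<sigma>3 B3 \<psi>3"
      "\<And>s. \<Phi> s = of_real (ln (real m3) / ln (real 3)) * s + \<psi>3 s"
    using expansion[of 3] by auto
  have c3: "c = ln (real m3) / ln (real 3)" using coeff[OF 3(3,4)] .
  have m3: "m3 = 3 ^ k"
  proof -
    have "real m3 = real (3 ^ k)"
      using powr[OF 3(1) _ c3] by (simp add: c_def[symmetric] k powr_realpow)
    then show ?thesis by (simp only: of_nat_eq_iff)
  qed
  define \<phi> where "\<phi> s = \<Phi> s - of_nat k * s" for s
  have "\<psi>2 = \<phi>" "\<psi>3 = \<phi>"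
    using 2(4)[folded c_def, unfolded k] 3(4)[folded c3, unfolded k] by (auto simp: \<phi>_def fun_eq_iff)
  define \<sigma> where "\<sigma> = max \<sigma>2 \<sigma>3"
  have "abs_dirichlet (power_denom 2) \<sigma> B2 \<phi>"
    using abs_dirichlet_mono[OF 2(3)] power_denom_power[of 2 k] power_denom_subset
    by (auto simp: m2 \<sigma>_def \<open>\<psi>2 = \<phi>\<close>)
  moreover have "abs_dirichlet (power_denom 3) \<sigma> B3 \<phi>"
    using abs_dirichlet_mono[OF 3(3)] power_denom_power[of 3 k] power_denom_subset
    by (auto simp: m3 \<sigma>_def \<open>\<psi>3 = \<phi>\<close>)
  ultimately have "abs_dirichlet (power_denom 2 \<inter> power_denom 3) \<sigma> B2 \<phi>"
    by (intro abs_dirichlet_Int[where R = "power_denom 3"] power_denom_subset)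
  moreover have "power_denom 2 \<inter> power_denom 3 = power_denom 1"
    by (intro power_denom_coprime_Int) (auto simp: coprime_iff_gcd_eq_1 gcd_red_nat[of 2] gcd_red_nat[of 3])
  ultimately have "abs_dirichlet (power_denom 1) \<sigma> B2 \<phi>" by simp
  then obtain a where "summable (\<lambda>k. norm (a (Suc k)) * real (Suc k) powr -\<sigma>)"
    and a: "\<And>s. Re s \<ge> \<sigma> \<Longrightarrow> (\<lambda>k. a (Suc k) * of_nat (Suc k) powr (- s)) sums \<phi> s"
    by (rule abs_dirichlet_dirichlet_series) (rule that)
  then have "has_dirichlet_series \<phi> a (half_plane \<sigma>)"
    unfolding has_dirichlet_series_def half_plane_def by (auto intro!: a simp del: of_nat_Suc)
  moreover have "\<sigma> \<ge> 0" using 2 by (simp add: \<sigma>_def)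
  moreover have "\<phi> analytic_on half_plane 0"
    unfolding \<phi>_def by (intro analytic_intros an)
  ultimately have "\<phi> \<in> dirichlet_fun" unfolding dirichlet_fun_def by blast
  then show ?thesis
    unfolding G_infinity_def using an im by (auto simp: \<phi>_def intro!: exI[of _ k] bexI[of _ \<phi>])
qed

text \<open>
  Closeness of \<open>n powr (- \<Phi> x)\<close> and \<open>n powr (- \<Phi> y)\<close> determines \<open>\<Phi> x - \<Phi> y\<close> only modulo
  \<open>2 * pi * \<i> / ln n\<close>; continuity along the segment from \<open>x\<close> to \<open>y\<close> removes the ambiguity.
\<close>

lemma uniformly_continuous_on_sublevel:
  assumes hol: "\<Phi> holomorphic_on half_plane 0" and n: "n \<ge> 2"
    and uc: "uniformly_continuous_on (half_plane 0) (nat_powr_neg n \<Phi>)"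
  shows "uniformly_continuous_on {s\<in>half_plane 0. 0 < Re (\<Phi> s) \<and> Re (\<Phi> s) < M} \<Phi>"
  unfolding uniformly_continuous_on_def
proof (intro allI impI)
  fix \<epsilon> :: real assume "\<epsilon> > 0"
  let ?F = "nat_powr_neg n \<Phi>"
  define l where "l = ln (real n)"
  have l: "l > 0" using n by (simp add: l_def)
  have Fexp: "?F s = exp (- \<Phi> s * of_real l)" for s
    using n by (simp add: nat_powr_neg_def of_nat_powr_eq_exp l_def)
  have "continuous (at 1) Ln" by (intro continuous_at_Ln) auto
  then obtain \<eta> where \<eta>: "\<eta> > 0" "\<And>w. dist w 1 < \<eta> \<Longrightarrow> dist (Ln w) (Ln 1) < \<epsilon> * l"
    unfolding continuous_at_eps_delta using \<open>\<epsilon> > 0\<close> l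
    by (metis mult_pos_pos)
  \<comment> \<open>\<open>exp (- M * l)\<close> is the lower bound for \<open>?F\<close> where Re
    \<Phi> < M. After division by it, the quotient of two values is within \<eta> of 1, for the
    continuity of \<open>Ln\<close>, and within 1/2, to avoid the branch cut.\<close>
  define e where "e = min \<eta> (1/2) * exp (- M * l)"
  have "e > 0" using \<eta> by (simp add: e_def)
  then obtain \<delta> where \<delta>: "\<delta> > 0"
     "\<And>s s'. s \<in> half_plane 0 \<Longrightarrow> s' \<in> half_plane 0 \<Longrightarrow> dist s' s < \<delta> \<Longrightarrow> dist (?F s') (?F s) < e"
    using uc unfolding uniformly_continuous_on_def by metis
  show "\<exists>d>0. \<forall>x\<in>{s\<in>half_plane 0. 0 < Re (\<Phi> s) \<and> Re (\<Phi> s) < M}.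
      \<forall>x'\<in>{s\<in>half_plane 0. 0 < Re (\<Phi> s) \<and> Re (\<Phi> s) < M}. dist x' x < d \<longrightarrow> dist (\<Phi> x') (\<Phi> x) < \<epsilon>"
  proof (intro exI[of _ \<delta>] conjI ballI impI)
    fix x y assume x: "x \<in> {s\<in>half_plane 0. 0 < Re (\<Phi> s) \<and> Re (\<Phi> s) < M}"
      and y: "y \<in> {s\<in>half_plane 0. 0 < Re (\<Phi> s) \<and> Re (\<Phi> s) < M}" and d: "dist y x < \<delta>"
    have "convex (half_plane 0)" unfolding half_plane_def by (rule convex_halfspace_Re_gt)
    then have seg: "closed_segment x y \<subseteq> half_plane 0"
      using x y by (intro closed_segment_subset) auto
    \<comment> \<open>The quotient of the values of \<open>?F\<close> at \<open>z\<close> and at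
      \<open>x\<close>. The lower bound is taken at the end point \<open>x\<close> alone, so the
      segment may leave the sublevel set.\<close>
    define w where "w z = exp (- (\<Phi> z - \<Phi> x) * of_real l)" for z
    have w: "dist (w z) 1 < min \<eta> (1/2)" if z: "z \<in> closed_segment x y" for z
    proof -
      have "dist z x \<le> dist y x"
        using segment_bound(1)[OF z] by (simp add: dist_norm)
      then have "dist (?F z) (?F x) < e" using \<delta>(2)[of x z] x z seg d by auto
      moreover have "?F z = ?F x * w z" by (simp add: Fexp w_def exp_add[symmetric] algebra_simps)
      ultimately have less: "norm (?F x) * dist (w z) 1 < e"
        by (simp add: dist_norm norm_mult[symmetric] algebra_simps)
      moreover have "norm (?F x) \<ge> exp (- M * l)" using x l by (simp add: Fexp)
      then have "exp (- M * l) * dist (w z) 1 \<le> norm (?F x) * dist (w z) 1"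
        by (intro mult_right_mono) auto
      then have "exp (- M * l) * dist (w z) 1 < e" using less by (rule order_le_less_trans)
      then have "dist (w z) 1 * exp (- M * l) < min \<eta> (1/2) * exp (- M * l)"
        unfolding e_def by (subst mult.commute)
      then show ?thesis by (simp only: mult_less_cancel_right_pos exp_gt_zero)
    qed
    have wpos: "w z \<notin> \<real>\<^sub>\<le>\<^sub>0" if "z \<in> closed_segment x y" for z
    proof -
      have "\<bar>Re (w z - 1)\<bar> < 1/2" using w[OF that] abs_Re_le_cmod[of "w z - 1"] by (simp add: dist_norm)
      then show ?thesis by (auto simp: complex_nonpos_Reals_iff)
    qed
    \<comment> \<open>The principal logarithm of \<open>w\<close> minus the continuous one given by
      \<Phi>. It takes values in the multiples of 2 * pi * \<i> and vanishes at
      \<open>x\<close>.\<close>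
    define u where "u z = Ln (w z) + (\<Phi> z - \<Phi> x) * of_real l" for z
    have cont: "continuous_on (closed_segment x y) \<Phi>"
      using holomorphic_on_imp_continuous_on[OF hol] seg continuous_on_subset by blast
    have "continuous_on (closed_segment x y) w"
      unfolding w_def by (intro continuous_intros cont)
    then have "continuous_on (closed_segment x y) u"
      unfolding u_def using wpos by (intro continuous_intros cont) auto
    moreover have "exp (u z) = 1" for z
      by (simp add: u_def exp_add w_def) (simp add: algebra_simps flip: exp_add)
    ultimately have "u y = u x"
      by (intro constant_exp_imp_constant[of "closed_segment x y" u 1]) auto
    then have "(\<Phi> y - \<Phi> x) * of_real l = - Ln (w y)" by (simp add: u_def w_def add_eq_0_iff)
    then have "dist (\<Phi> y) (\<Phi> x) * l = norm (Ln (w y))"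
      using l by (metis abs_of_pos dist_norm norm_minus_cancel norm_mult norm_of_real)
    also have "\<dots> < \<epsilon> * l" using \<eta>(2)[of "w y"] w[of y] by simp
    finally show "dist (\<Phi> y) (\<Phi> x) < \<epsilon>" using l by simp
  qed (rule \<delta>(1))
qed

section \<open>Bohr's theorem\<close>

text \<open>The majorant may vary along the segment. This yields bounds that do not depend on the
  length of a horizontal side, and only logarithmic growth in the height for the vertical side left
  of 0.\<close>

lemma contour_integral_linepath_bound:
  assumes "continuous_on (closed_segment a b) f" "(h has_integral J) {0..1}"
    and "\<And>t. t \<in> {0..1} \<Longrightarrow> norm (f (linepath a b t)) \<le> h t"
  shows "norm (contour_integral (linepath a b) f) \<le> J * norm (b - a)"
proof -
  let ?g = "\<lambda>t. f (linepath a b t) * (b - a)"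
  have "f contour_integrable_on linepath a b"
    using assms(1) by (rule contour_integrable_continuous_linepath)
  then have "(?g has_integral contour_integral (linepath a b) f) {0..1}"
    using has_contour_integral_integral has_contour_integral_linepath by blast
  moreover have "((\<lambda>t. h t * norm (b - a)) has_integral J * norm (b - a)) {0..1}"
    using assms(2) by (rule has_integral_mult_left)
  moreover have "norm (?g t) \<le> h t * norm (b - a)" if "t \<in> {0..1}" for t
    using assms(3)[OF that] by (simp add: norm_mult mult_right_mono)
  ultimately show ?thesis
    using integral_norm_bound_integral[of ?g "{0..1}" "\<lambda>t. h t * norm (b - a)"]
    by (metis has_integral_integrable integral_unique)
qed

lemma contour_integral_rectpath:
  assumes "continuous_on (path_image (rectpath (Complex x1 y1) (Complex x2 y2))) f" "x1 \<le> x2" "y1 \<le> y2"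
  shows "contour_integral (rectpath (Complex x1 y1) (Complex x2 y2)) f =
    contour_integral (linepath (Complex x1 y1) (Complex x2 y1)) f +
    contour_integral (linepath (Complex x2 y1) (Complex x2 y2)) f -
    contour_integral (linepath (Complex x1 y2) (Complex x2 y2)) f -
    contour_integral (linepath (Complex x1 y1) (Complex x1 y2)) f"
proof -
  let ?a = "Complex x1 y1" and ?b = "Complex x2 y1" and ?c = "Complex x2 y2" and ?d = "Complex x1 y2"
  have "path_image (rectpath ?a ?c) =
      closed_segment ?a ?b \<union> closed_segment ?b ?c \<union> closed_segment ?c ?d \<union> closed_segment ?d ?a"
    by (simp add: rectpath_def Let_def path_image_join Un_assoc)
  then have "continuous_on (closed_segment p q) f"
    if "(p, q) \<in> {(?a, ?b), (?b, ?c), (?c, ?d), (?d, ?a)}" for p q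
    using that by (auto intro: continuous_on_subset[OF assms(1)])
  then have "f contour_integrable_on linepath ?a ?b" "f contour_integrable_on linepath ?b ?c"
      "f contour_integrable_on linepath ?c ?d" "f contour_integrable_on linepath ?d ?a"
    by (auto intro!: contour_integrable_continuous_linepath)
  then have "contour_integral (rectpath ?a ?c) f =
      contour_integral (linepath ?a ?b) f + contour_integral (linepath ?b ?c) f +
      contour_integral (linepath ?c ?d) f + contour_integral (linepath ?d ?a) f"
    by (simp add: rectpath_def Let_def contour_integrable_joinI)
  moreover have "contour_integral (linepath ?c ?d) f = - contour_integral (linepath ?d ?c) f"
    "contour_integral (linepath ?d ?a) f = - contour_integral (linepath ?a ?d) f"
    using contour_integral_reversepath[of "linepath ?d ?c" f] contour_integral_reversepath[of "linepath ?a ?d" f]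
    by simp_all
  ultimately show ?thesis by simp
qed

lemma continuous_on_div_rect:
  assumes "f holomorphic_on U" "path_image p \<subseteq> U - {0}"
  shows "continuous_on (path_image p) (\<lambda>w. f w / w)"
  using assms by (intro continuous_intros continuous_on_subset[OF holomorphic_on_imp_continuous_on[OF assms(1)]]) auto

text \<open>Cauchy's formula on a rectangle around the pole at 0. It serves both for a single power,
  with the left side sent to infinity, and for \<open>g (s + w) * of_real x powr w\<close>, where
  the left side must stay in the domain.\<close>

lemma vertical_integral_residue:
  assumes f: "f holomorphic_on U" "open U" "convex U"
    and U: "{w. -l \<le> Re w \<and> Re w \<le> c} \<subseteq> U" and pos: "l > 0" "c > 0" "R > 0"
  shows "contour_integral (linepath (Complex c (-R)) (Complex c R)) (\<lambda>w. f w / w) - 2 * pi * \<i> * f 0 =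
    contour_integral (linepath (Complex (-l) R) (Complex c R)) (\<lambda>w. f w / w) -
    contour_integral (linepath (Complex (-l) (-R)) (Complex c (-R))) (\<lambda>w. f w / w) +
    contour_integral (linepath (Complex (-l) (-R)) (Complex (-l) R)) (\<lambda>w. f w / w)"
proof -
  let ?p = "rectpath (Complex (-l) (-R)) (Complex c R)"
  have img: "path_image ?p \<subseteq> U - {0}"
    using pos U by (subst path_image_rectpath) auto
  have 0: "0 \<in> U" using U pos by auto
  have "((\<lambda>w. f w / (w - 0)) has_contour_integral (2 * pi * \<i> * winding_number ?p 0 * f 0)) ?p"
    using f img 0 by (intro Cauchy_integral_formula_convex_simple[where S = U]) (auto simp: interior_open)
  moreover have "winding_number ?p 0 = 1"
    using pos by (intro winding_number_rectpath) (auto simp: in_box_complex_iff)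
  ultimately have "contour_integral ?p (\<lambda>w. f w / w) = 2 * pi * \<i> * f 0"
    by (simp add: contour_integral_unique)
  moreover have "continuous_on (path_image ?p) (\<lambda>w. f w / w)"
    using continuous_on_div_rect f img by blast
  ultimately show ?thesis
    using contour_integral_rectpath[of "-l" "-R" c R "\<lambda>w. f w / w"] pos by (simp add: algebra_simps)
qed

lemma vertical_integral_shift:
  assumes f: "f holomorphic_on {w. Re w > 0}" and pos: "0 < c" "c \<le> l" "R > 0"
  shows "contour_integral (linepath (Complex c (-R)) (Complex c R)) f =
    contour_integral (linepath (Complex c (-R)) (Complex l (-R))) f -
    contour_integral (linepath (Complex c R) (Complex l R)) f +
    contour_integral (linepath (Complex l (-R)) (Complex l R)) f"
proof -
  let ?p = "rectpath (Complex c (-R)) (Complex l R)"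
  have img: "path_image ?p \<subseteq> {w. Re w > 0}"
    using pos by (subst path_image_rectpath) auto
  have "(f has_contour_integral 0) ?p"
    by (rule Cauchy_theorem_convex_simple[OF f convex_halfspace_Re_gt]) (use img in auto)
  then have "contour_integral ?p f = 0" by (rule contour_integral_unique)
  moreover have "continuous_on (path_image ?p) f"
    using continuous_on_subset[OF holomorphic_on_imp_continuous_on[OF f] img] .
  ultimately show ?thesis
    using contour_integral_rectpath[of c "-R" l R f] pos by (simp add: algebra_simps)
qed

section \<open>Truncated Perron formula for a single power\<close>

lemma powr_holomorphic_on_UNIV:
  "y > 0 \<Longrightarrow> (\<lambda>w. complex_of_real y powr w) holomorphic_on U"
  by (intro holomorphic_intros) auto

text \<open>\<open>norm w \<ge> \<bar>R\<bar>\<close> on the side, and \<open>y powr Re w\<close> is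
  integrated exactly. The bound is not proportional to b - a, so one end can go to infinity in the
  direction of decay.\<close>

lemma horizontal_powr_bound:
  assumes "y > 0" "y \<noteq> 1" "R \<noteq> 0" "a < b"
  shows "norm (contour_integral (linepath (Complex a R) (Complex b R)) (\<lambda>w. of_real y powr w / w)) \<le>
    (y powr b - y powr a) / (\<bar>R\<bar> * ln y)"
proof -
  let ?H = "\<lambda>t. y powr (a + t * (b - a)) / (ln y * (b - a) * \<bar>R\<bar>)"
  let ?h = "\<lambda>t. y powr (a + t * (b - a)) / \<bar>R\<bar>"
  have "ln y \<noteq> 0" using assms by simp
  have "(?h has_integral (?H 1 - ?H 0)) {0..1}"
  proof (rule fundamental_theorem_of_calculus)
    fix t :: real assume "t \<in> {0..1}"
    have "((\<lambda>t. y powr (a + t * (b - a))) has_real_derivative y powr (a + t * (b - a)) * (ln y * (b - a)))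
        (at t within {0..1})"
      using assms unfolding powr_def by (auto intro!: derivative_eq_intros)
    from DERIV_cdivide[OF this, of "ln y * (b - a) * \<bar>R\<bar>"]
    have "(?H has_real_derivative ?h t) (at t within {0..1})"
      using assms \<open>ln y \<noteq> 0\<close> by simp
    then show "(?H has_vector_derivative ?h t) (at t within {0..1})"
      by (simp add: has_real_derivative_iff_has_vector_derivative)
  qed auto
  moreover have "continuous_on (closed_segment (Complex a R) (Complex b R)) (\<lambda>w. of_real y powr w / w)"
    using assms by (intro continuous_intros) (auto simp: closed_segment_same_Im)
  moreover have "norm (of_real y powr (linepath (Complex a R) (Complex b R) t) / linepath (Complex a R) (Complex b R) t) \<le> ?h t"
    if "t \<in> {0..1}" for t
  proof -
    let ?w = "linepath (Complex a R) (Complex b R) t"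
    have "Re ?w = a + t * (b - a)" "Im ?w = R" by (simp_all add: linepath_def algebra_simps)
    moreover have "\<bar>R\<bar> \<le> norm ?w" using abs_Im_le_cmod[of ?w] calculation by simp
    ultimately show ?thesis
      using assms by (auto simp: norm_divide norm_powr_real_powr intro!: divide_left_mono mult_pos_pos)
  qed
  ultimately have "norm (contour_integral (linepath (Complex a R) (Complex b R)) (\<lambda>w. of_real y powr w / w))
      \<le> (?H 1 - ?H 0) * norm (Complex b R - Complex a R)"
    by (intro contour_integral_linepath_bound)
  also have "norm (Complex b R - Complex a R) = b - a"
    using assms by (simp add: cmod_def)
  also have "?H 1 - ?H 0 = (y powr b - y powr a) / (ln y * (b - a) * \<bar>R\<bar>)"
    by (simp add: diff_divide_distrib)
  also have "\<dots> * (b - a) = (y powr b - y powr a) / (\<bar>R\<bar> * ln y)"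
    using assms \<open>ln y \<noteq> 0\<close> by (simp add: mult.commute)
  finally show ?thesis .
qed

lemma vertical_powr_bound:
  assumes "y > 0" "x \<noteq> 0" "R > 0"
  shows "norm (contour_integral (linepath (Complex x (-R)) (Complex x R)) (\<lambda>w. of_real y powr w / w)) \<le>
    y powr x / \<bar>x\<bar> * (2 * R)"
proof -
  have "norm (contour_integral (linepath (Complex x (-R)) (Complex x R)) (\<lambda>w. of_real y powr w / w)) \<le>
      y powr x / \<bar>x\<bar> * norm (Complex x R - Complex x (-R))"
  proof (rule contour_integral_bound_linepath)
    show "(\<lambda>w. of_real y powr w / w) contour_integrable_on linepath (Complex x (-R)) (Complex x R)"
      using assms by (intro contour_integrable_continuous_linepath continuous_intros)
        (auto simp: closed_segment_same_Re)
    fix w assume "w \<in> closed_segment (Complex x (-R)) (Complex x R)"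
    then have "Re w = x" by (auto simp: closed_segment_same_Re)
    then show "norm (of_real y powr w / w) \<le> y powr x / \<bar>x\<bar>"
      using assms abs_Re_le_cmod[of w]
      by (auto simp: norm_divide norm_powr_real_powr intro!: divide_left_mono mult_pos_pos)
  qed auto
  also have "Complex x R - Complex x (-R) = of_real (2 * R) * \<i>"
    by (simp add: complex_eq_iff)
  also have "norm \<dots> = 2 * R"
    using assms by (simp add: norm_mult)
  finally show ?thesis .
qed

text \<open>The contour is pushed to where \<open>y powr w\<close> decays: left across the pole if
  \<open>y > 1\<close>, right if \<open>y < 1\<close>. In the limit the far vertical side vanishes
  and each horizontal side contributes at most
  \<open>y powr c / (R * \<bar>ln y\<bar>)\<close>.\<close>

lemma truncated_perron:
  assumes "y > 0" "y \<noteq> 1" "c > 0" "R > 0"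
  shows "norm (contour_integral (linepath (Complex c (-R)) (Complex c R)) (\<lambda>w. of_real y powr w / w)
      - (if y > 1 then 2 * pi * \<i> else 0)) \<le> 2 * y powr c / (R * \<bar>ln y\<bar>)"
proof (cases "y > 1")
  case True
  let ?f = "\<lambda>w. of_real y powr w / w"
  let ?X = "norm (contour_integral (linepath (Complex c (-R)) (Complex c R)) ?f - 2 * pi * \<i>)"
  have lny: "ln y > 0" using True by simp
  have le: "?X \<le> 2 * y powr c / (R * ln y) + y powr -l / l * (2 * R)" if l: "l > 0" for l
  proof -
    let ?A = "contour_integral (linepath (Complex (-l) R) (Complex c R)) ?f"
    let ?B = "contour_integral (linepath (Complex (-l) (-R)) (Complex c (-R))) ?f"
    let ?C = "contour_integral (linepath (Complex (-l) (-R)) (Complex (-l) R)) ?f"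
    have "contour_integral (linepath (Complex c (-R)) (Complex c R)) ?f - 2 * pi * \<i> = ?A - ?B + ?C"
      using vertical_integral_residue[OF powr_holomorphic_on_UNIV[OF assms(1), of UNIV], of l c R] assms l
      by simp
    then have "?X \<le> norm ?A + norm ?B + norm ?C"
      using norm_triangle_ineq[of "?A - ?B" ?C] norm_triangle_ineq4[of ?A ?B] by simp
    moreover have "norm ?A \<le> (y powr c - y powr -l) / (\<bar>R\<bar> * ln y)"
      using assms l by (intro horizontal_powr_bound) auto
    moreover have "norm ?B \<le> (y powr c - y powr -l) / (\<bar>-R\<bar> * ln y)"
      using assms l by (intro horizontal_powr_bound) auto
    moreover have "(y powr c - y powr -l) / (R * ln y) \<le> y powr c / (R * ln y)"
      using assms lny by (intro divide_right_mono) auto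
    moreover have "norm ?C \<le> y powr -l / \<bar>-l\<bar> * (2 * R)"
      using assms l by (intro vertical_powr_bound) auto
    ultimately show ?thesis using assms l by simp
  qed
  have "((\<lambda>l. 2 * y powr c / (R * ln y) + y powr -l / l * (2 * R)) \<longlongrightarrow> 2 * y powr c / (R * ln y) + 0 * (2 * R)) at_top"
    using True by (intro tendsto_intros) real_asymp
  then have "?X \<le> 2 * y powr c / (R * ln y) + 0 * (2 * R)"
  proof (rule tendsto_lowerbound)
    show "eventually (\<lambda>l. ?X \<le> 2 * y powr c / (R * ln y) + y powr -l / l * (2 * R)) at_top"
      using eventually_gt_at_top[of 0] by eventually_elim (rule le)
  qed auto
  then show ?thesis using True lny by simp
next
  case False
  then have y: "y < 1" using assms by simp
  let ?f = "\<lambda>w. of_real y powr w / w"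
  let ?X = "norm (contour_integral (linepath (Complex c (-R)) (Complex c R)) ?f)"
  have lny: "ln y < 0" using y assms by simp
  have le: "?X \<le> 2 * y powr c / (R * \<bar>ln y\<bar>) + y powr l / l * (2 * R)" if l: "l > c" for l
  proof -
    let ?A = "contour_integral (linepath (Complex c R) (Complex l R)) ?f"
    let ?B = "contour_integral (linepath (Complex c (-R)) (Complex l (-R))) ?f"
    let ?C = "contour_integral (linepath (Complex l (-R)) (Complex l R)) ?f"
    have "?f holomorphic_on {w. Re w > 0}"
      using assms by (intro holomorphic_intros) auto
    then have "contour_integral (linepath (Complex c (-R)) (Complex c R)) ?f = ?B - ?A + ?C"
      using vertical_integral_shift[of ?f c l R] assms l by simp
    then have "?X \<le> norm ?A + norm ?B + norm ?C"
      using norm_triangle_ineq[of "?B - ?A" ?C] norm_triangle_ineq4[of ?B ?A] by simp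
    moreover have "norm ?A \<le> (y powr l - y powr c) / (\<bar>R\<bar> * ln y)"
      using assms l by (intro horizontal_powr_bound) auto
    moreover have "norm ?B \<le> (y powr l - y powr c) / (\<bar>-R\<bar> * ln y)"
      using assms l by (intro horizontal_powr_bound) auto
    moreover have "(y powr l - y powr c) / (R * ln y) \<le> y powr c / (R * \<bar>ln y\<bar>)"
    proof -
      have "(y powr l - y powr c) / (R * ln y) = (y powr c - y powr l) / (R * \<bar>ln y\<bar>)"
        using lny assms by (simp add: field_simps)
      also have "\<dots> \<le> y powr c / (R * \<bar>ln y\<bar>)"
        using assms by (intro divide_right_mono) auto
      finally show ?thesis .
    qed
    moreover have "norm ?C \<le> y powr l / \<bar>l\<bar> * (2 * R)"
      using assms l by (intro vertical_powr_bound) auto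
    ultimately show ?thesis using assms l by simp
  qed
  have "((\<lambda>l. 2 * y powr c / (R * \<bar>ln y\<bar>) + y powr l / l * (2 * R)) \<longlongrightarrow> 2 * y powr c / (R * \<bar>ln y\<bar>) + 0 * (2 * R)) at_top"
    using y assms by (intro tendsto_intros) real_asymp
  then have "?X \<le> 2 * y powr c / (R * \<bar>ln y\<bar>) + 0 * (2 * R)"
  proof (rule tendsto_lowerbound)
    show "eventually (\<lambda>l. ?X \<le> 2 * y powr c / (R * \<bar>ln y\<bar>) + y powr l / l * (2 * R)) at_top"
      using eventually_gt_at_top[of c] by eventually_elim (rule le)
  qed auto
  then show ?thesis using False by simp
qed

lemma vertical_quotient_bound:
  assumes "continuous_on (closed_segment (Complex (-l) (-R)) (Complex (-l) R)) f" "l > 0" "R > 0"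
    and "\<And>w. Re w = -l \<Longrightarrow> norm (f w) \<le> C"
  shows "norm (contour_integral (linepath (Complex (-l) (-R)) (Complex (-l) R)) (\<lambda>w. f w / w)) \<le>
    2 * C * arsinh (R / l)"
proof -
  let ?z = "linepath (Complex (-l) (-R)) (Complex (-l) R)"
  let ?u = "\<lambda>t. (-R + t * (2 * R)) / l"
  let ?h = "\<lambda>t. C / (l * sqrt ((?u t)\<^sup>2 + 1))"
  let ?H = "\<lambda>t. C * arsinh (?u t) / (2 * R)"
  have "(?h has_integral (?H 1 - ?H 0)) {0..1}"
  proof (rule fundamental_theorem_of_calculus)
    fix t :: real
    have "((\<lambda>t. arsinh (?u t)) has_real_derivative 1 / sqrt ((?u t)\<^sup>2 + 1) * (2 * R / l)) (at t within {0..1})"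
      by (rule DERIV_chain2[OF arsinh_real_has_field_derivative])
         (use \<open>l > 0\<close> in \<open>auto intro!: derivative_eq_intros\<close>)
    from DERIV_cdivide[OF DERIV_cmult[OF this, of C], of "2 * R"]
    have "(?H has_real_derivative ?h t) (at t within {0..1})"
      using assms by (simp add: mult_ac)
    then show "(?H has_vector_derivative ?h t) (at t within {0..1})"
      by (simp add: has_real_derivative_iff_has_vector_derivative)
  qed auto
  moreover have "continuous_on (closed_segment (Complex (-l) (-R)) (Complex (-l) R)) (\<lambda>w. f w / w)"
    using assms by (intro continuous_intros) (auto simp: closed_segment_same_Re)
  moreover have "norm (f (?z t) / ?z t) \<le> ?h t" for t
  proof -
    have re: "Re (?z t) = -l" and im: "Im (?z t) = -R + t * (2 * R)"
      by (simp_all add: linepath_def algebra_simps)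
    have "l * sqrt ((?u t)\<^sup>2 + 1) = sqrt (l\<^sup>2 * ((?u t)\<^sup>2 + 1))"
      using \<open>l > 0\<close> by (simp add: real_sqrt_mult)
    also have "l\<^sup>2 * ((?u t)\<^sup>2 + 1) = (Re (?z t))\<^sup>2 + (Im (?z t))\<^sup>2"
      using \<open>l > 0\<close> unfolding re im by (simp add: power_divide field_simps)
    also have "sqrt \<dots> = norm (?z t)" by (simp add: cmod_def)
    finally have "l * sqrt ((?u t)\<^sup>2 + 1) = norm (?z t)" .
    moreover have "norm (f (?z t)) \<le> C" using re by (rule assms(4))
    ultimately show ?thesis by (simp only: norm_divide divide_right_mono norm_ge_zero)
  qed
  ultimately have "norm (contour_integral ?z (\<lambda>w. f w / w)) \<le>
      (?H 1 - ?H 0) * norm (Complex (-l) R - Complex (-l) (-R))"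
    by (intro contour_integral_linepath_bound)
  also have "Complex (-l) R - Complex (-l) (-R) = of_real (2 * R) * \<i>"
    by (simp add: complex_eq_iff)
  also have "norm \<dots> = 2 * R"
    using assms by (simp add: norm_mult)
  also have "(?H 1 - ?H 0) * (2 * R) = 2 * C * arsinh (R / l)"
    using assms by (simp add: arsinh_minus_real minus_divide_left[symmetric] field_simps)
  finally show ?thesis .
qed

text \<open>The error in Perron's formula contains 1 / \<bar>ln y\<bar>, which blows up at y = 1.
  Cutting at a half-integer keeps y away from 1 for all \<open>n\<close>; the bound is ln t \<le> t
  - 1 applied to 1 / y or to y.\<close>

lemma abs_ln_half_integer_quotient:
  assumes "n \<ge> 1"
  shows "\<bar>ln ((real N + 1/2) / real n)\<bar> \<ge> 1 / (2 * (real N + 1))"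
proof (cases "n \<le> N")
  case True
  let ?y = "(real N + 1/2) / real n"
  have "1 / (2 * (real N + 1)) \<le> 1 - real N / (real N + 1/2)" by (simp add: field_simps)
  also have "\<dots> \<le> 1 - 1 / ?y" using True by (simp add: divide_right_mono)
  also have "\<dots> \<le> ln ?y"
    using ln_le_minus_one[of "1 / ?y"] assms by (simp add: ln_div)
  finally show ?thesis by linarith
next
  case False
  let ?y = "(real N + 1/2) / real n"
  have n: "real n \<ge> real N + 1" using False by linarith
  then have "?y \<le> (real N + 1/2) / (real N + 1)" by (intro divide_left_mono) auto
  then have "1 / (2 * (real N + 1)) \<le> 1 - ?y"
    by (simp add: field_simps)
  also have "\<dots> \<le> - ln ?y"
    using ln_le_minus_one[of ?y] n by simp
  finally show ?thesis by linarith
qed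

text \<open>The formula for a single power is applied termwise with
  \<open>y k = x / real (Suc k)\<close>, and \<open>y k > 1\<close> holds exactly for the first
  \<open>N\<close> terms. The factor 4 * (N + 1) is the 2 of that formula times the 2 * (N + 1) of
  the half-integer bound.\<close>

lemma truncated_perron_series:
  fixes a :: "nat \<Rightarrow> complex" and g :: "complex \<Rightarrow> complex" and N :: nat
  assumes sm: "summable (\<lambda>k. norm (a (Suc k)) * real (Suc k) powr -\<sigma>)"
    and conv: "\<And>s. Re s \<ge> \<sigma> \<Longrightarrow> (\<lambda>k. a (Suc k) * of_nat (Suc k) powr (- s)) sums g s"
    and pos: "c > 0" "Re s + c \<ge> \<sigma>" "R > 0"
  defines "x \<equiv> real N + 1/2"
  shows "norm (contour_integral (linepath (Complex c (-R)) (Complex c R)) (\<lambda>w. g (s + w) * of_real x powr w / w)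
      - 2 * pi * \<i> * (\<Sum>k<N. a (Suc k) * of_nat (Suc k) powr (- s)))
    \<le> 4 * (real N + 1) * x powr c / R * (\<Sum>k. norm (a (Suc k)) * real (Suc k) powr -\<sigma>)"
proof -
  let ?L = "linepath (Complex c (-R)) (Complex c R)"
  let ?S = "closed_segment (Complex c (-R)) (Complex c R)"
  define y where "y k = x / real (Suc k)" for k
  define b where "b k = a (Suc k) * of_nat (Suc k) powr (- s)" for k
  define f where "f k w = b k * (of_real (y k) powr w / w)" for k w
  have x: "x > 0" by (simp add: x_def)
  have y: "y k > 0" for k using x by (simp add: y_def)
  have y1: "y k \<noteq> 1" for k
  proof
    assume "y k = 1"
    then have "real (2 * N + 1) = real (2 * Suc k)" by (simp add: y_def x_def field_simps)
    then have "2 * N + 1 = 2 * Suc k" by (simp only: of_nat_eq_iff)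
    then show False by presburger
  qed
  have Re_S: "Re w = c" if "w \<in> ?S" for w using that by (auto simp: closed_segment_same_Re)
  have term_eq: "b k * of_real (y k) powr w = a (Suc k) * of_nat (Suc k) powr (- (s + w)) * of_real x powr w" for k w
  proof -
    have "of_real (y k * real (Suc k)) powr w = of_real (y k) powr w * of_real (real (Suc k)) powr w"
      using y[of k] by (subst of_real_mult, subst powr_times_real) auto
    then have "of_real x powr w = of_real (y k) powr w * of_nat (Suc k) powr w"
      by (simp add: y_def del: of_nat_Suc)
    moreover have "(of_nat (Suc k) :: complex) powr (- (s + w)) * of_nat (Suc k) powr w = of_nat (Suc k) powr (-s)"
      by (simp add: powr_add[symmetric] del: of_nat_Suc)
    ultimately show ?thesis by (simp add: b_def mult_ac del: of_nat_Suc)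
  qed
  have bnorm: "norm (b k) * y k powr c \<le> x powr c * (norm (a (Suc k)) * real (Suc k) powr -\<sigma>)" for k
  proof -
    have "norm (b k) = norm (a (Suc k)) * real (Suc k) powr (- Re s)"
      using norm_powr_real_powr[of "of_nat (Suc k)" "-s"] by (simp add: b_def norm_mult del: of_nat_Suc)
    moreover have "y k powr c = x powr c * real (Suc k) powr -c"
      using x by (simp add: y_def powr_divide powr_minus_divide del: of_nat_Suc)
    moreover have le: "real (Suc k) powr (- Re s) * real (Suc k) powr -c \<le> real (Suc k) powr -\<sigma>"
      unfolding powr_add[symmetric] using pos by (intro powr_mono) auto
    ultimately show ?thesis
      using mult_left_mono[OF le, of "x powr c * norm (a (Suc k))"] by (simp add: mult_ac del: of_nat_Suc)
  qed
  have contf: "continuous_on ?S (f k)" for k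
    unfolding f_def using y[of k] Re_S pos by (intro continuous_intros) force+
  \<comment> \<open>\<open>norm w \<ge> c\<close> on the segment, so the terms are dominated
    uniformly and the series can be integrated term by term.\<close>
  have "uniform_limit ?S (\<lambda>M w. \<Sum>k<M. f k w) (\<lambda>w. \<Sum>k. f k w) sequentially"
  proof (rule Weierstrass_m_test)
    show "norm (f k w) \<le> x powr c / c * (norm (a (Suc k)) * real (Suc k) powr -\<sigma>)" if "w \<in> ?S" for k w
    proof -
      have "norm w \<ge> c" using abs_Re_le_cmod[of w] Re_S[OF that] by simp
      then have "norm (f k w) \<le> norm (b k) * y k powr c / c"
        using y[of k] Re_S[OF that] pos
        by (auto simp: f_def norm_mult norm_divide norm_powr_real_powr intro!: divide_left_mono mult_pos_pos)
      also have "\<dots> \<le> x powr c * (norm (a (Suc k)) * real (Suc k) powr -\<sigma>) / c"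
        using pos by (intro divide_right_mono bnorm) auto
      finally show ?thesis by simp
    qed
    show "summable (\<lambda>k. x powr c / c * (norm (a (Suc k)) * real (Suc k) powr -\<sigma>))"
      by (intro summable_mult sm)
  qed
  then obtain J where J: "((\<lambda>w. \<Sum>k. f k w) has_contour_integral J) ?L"
      "(\<lambda>k. contour_integral ?L (f k)) sums J"
    using contour_integral_sums_linepath[where f = f, OF _ contf] by blast
  have "(\<Sum>k. f k w) = g (s + w) * of_real x powr w / w" if "w \<in> ?S" for w
  proof -
    have "(\<lambda>k. a (Suc k) * of_nat (Suc k) powr (- (s + w)) * (of_real x powr w / w)) sums
        (g (s + w) * (of_real x powr w / w))"
      using Re_S[OF that] pos by (intro sums_mult2 conv) auto
    moreover have "f k w = a (Suc k) * of_nat (Suc k) powr (- (s + w)) * (of_real x powr w / w)" for k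
      using term_eq[of k w] by (simp add: f_def)
    ultimately show ?thesis by (simp add: sums_iff)
  qed
  then have JV: "contour_integral ?L (\<lambda>w. g (s + w) * of_real x powr w / w) = J"
    using contour_integral_eq[of ?L "\<lambda>w. \<Sum>k. f k w"] contour_integral_unique[OF J(1)] by simp
  define r where "r k = (if k < N then 2 * pi * \<i> * b k else 0)" for k
  have "r sums (\<Sum>k<N. r k)" by (rule sums_finite) (auto simp: r_def)
  then have "r sums (2 * pi * \<i> * (\<Sum>k<N. b k))" by (simp add: r_def sum_distrib_left)
  from sums_diff[OF J(2) this]
  have diff: "(\<lambda>k. contour_integral ?L (f k) - r k) sums (J - 2 * pi * \<i> * (\<Sum>k<N. b k))" .
  have bound: "norm (contour_integral ?L (f k) - r k) \<le>
      4 * (real N + 1) * x powr c / R * (norm (a (Suc k)) * real (Suc k) powr -\<sigma>)" for k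
  proof -
    let ?p = "contour_integral ?L (\<lambda>w. of_real (y k) powr w / w)"
    have "y k > 1 \<longleftrightarrow> k < N" by (auto simp: y_def x_def field_simps)
    moreover have "contour_integral ?L (f k) = b k * ?p"
      unfolding f_def[abs_def] using y[of k] Re_S pos
      by (intro contour_integral_lmul contour_integrable_continuous_linepath continuous_intros) force+
    ultimately have "contour_integral ?L (f k) - r k = b k * (?p - (if y k > 1 then 2 * pi * \<i> else 0))"
      by (auto simp: r_def algebra_simps)
    then have "norm (contour_integral ?L (f k) - r k) \<le> norm (b k) * (2 * y k powr c / (R * \<bar>ln (y k)\<bar>))"
      using truncated_perron[OF y y1 \<open>c > 0\<close> \<open>R > 0\<close>, of k] by (simp only: norm_mult mult_left_mono norm_ge_zero)
    also have "\<dots> = norm (b k) * y k powr c * (2 / R) * (1 / \<bar>ln (y k)\<bar>)" by simp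
    also have "\<dots> \<le> norm (b k) * y k powr c * (2 / R) * (2 * (real N + 1))"
    proof (rule mult_left_mono)
      have le: "1 / (2 * (real N + 1)) \<le> \<bar>ln (y k)\<bar>"
        using abs_ln_half_integer_quotient[of "Suc k" N] by (simp add: y_def x_def del: of_nat_Suc)
      moreover have "0 < 1 / (2 * (real N + 1))" by simp
      ultimately have "1 / \<bar>ln (y k)\<bar> \<le> 1 / (1 / (2 * (real N + 1)))"
        by (intro divide_left_mono mult_pos_pos) linarith+
      then show "1 / \<bar>ln (y k)\<bar> \<le> 2 * (real N + 1)" by simp
    qed (use pos in auto)
    also have "\<dots> = 4 * (real N + 1) / R * (norm (b k) * y k powr c)" by simp
    also have "\<dots> \<le> 4 * (real N + 1) / R * (x powr c * (norm (a (Suc k)) * real (Suc k) powr -\<sigma>))"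
      using pos by (intro mult_left_mono bnorm) auto
    finally show ?thesis by (simp only: mult.assoc times_divide_eq_left times_divide_eq_right)
  qed
  have "norm (suminf (\<lambda>k. contour_integral ?L (f k) - r k)) \<le>
      (\<Sum>k. 4 * (real N + 1) * x powr c / R * (norm (a (Suc k)) * real (Suc k) powr -\<sigma>))"
    by (rule norm_suminf_le[OF bound summable_mult[OF sm]])
  also have "\<dots> = 4 * (real N + 1) * x powr c / R * (\<Sum>k. norm (a (Suc k)) * real (Suc k) powr -\<sigma>)"
    by (rule suminf_mult[OF sm])
  finally show ?thesis using diff JV by (simp add: sums_iff b_def)
qed

text \<open>
  Bohr's theorem. In Perron's formula for the partial sum up to \<open>N\<close>, cut off at height
  \<open>R = x powr (c + 2)\<close> with \<open>x = N + 1/2\<close>, the contour is moved to the left of \<open>0\<close>, where \<open>x powr w\<close>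
  decays like a power of \<open>x\<close>; the residue is \<open>g s\<close>, and boundedness of \<open>g\<close> costs only a
  factor of order \<open>ln R\<close>.
\<close>

lemma bohr_convergence:
  assumes hol: "g holomorphic_on half_plane 0" and bd: "\<And>s. s \<in> half_plane 0 \<Longrightarrow> norm (g s) \<le> K"
    and sm: "summable (\<lambda>k. norm (a (Suc k)) * real (Suc k) powr -\<sigma>)"
    and conv: "\<And>s. Re s \<ge> \<sigma> \<Longrightarrow> (\<lambda>k. a (Suc k) * of_nat (Suc k) powr (- s)) sums g s"
  shows "has_dirichlet_series g a (half_plane 0)"
  unfolding has_dirichlet_series_def
proof
  fix s assume s: "s \<in> half_plane 0"
  \<comment> \<open>Moving left by half of \<open>Re s\<close> keeps \<open>s + w\<close> in the
    half-plane, while \<open>x powr -l\<close> still tends to 0. The choice of \<open>c\<close> puts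
    \<open>s + w\<close> into the region of absolute convergence on the starting line.\<close>
  define l where "l = Re s / 2"
  define c where "c = max \<sigma> 0 + 1"
  have pos: "l > 0" "c > 0" "Re s + c \<ge> \<sigma>" "Re s > l"
    using s by (auto simp: l_def c_def half_plane_def)
  define A where "A = (\<Sum>k. norm (a (Suc k)) * real (Suc k) powr -\<sigma>)"
  define S where "S N = (\<Sum>k<N. a (Suc k) * of_nat (Suc k) powr (- s))" for N
  \<comment> \<open>The summands come from Perron truncation, the two horizontal sides and the
    shifted vertical side. With this \<open>R\<close> they are of order x powr -1, x powr -2 and x
    powr -l * ln x.\<close>
  define E where "E N = (let x = real N + 1/2; R = x powr (c + 2) in
     4 * (real N + 1) * x powr c / R * A + 2 * (K * x powr c / R * (c + l)) + 2 * (K * x powr -l) * arsinh (R / l))" for N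
  have K0: "K \<ge> 0" using bd[OF s] norm_ge_zero order_trans by blast
  have le: "norm (2 * pi * \<i> * (S N - g s)) \<le> E N" if "N \<ge> 1" for N
  proof -
    define x where "x = real N + 1/2"
    define R where "R = x powr (c + 2)"
    have x: "x > 1" using that by (simp add: x_def)
    have R: "R > 0" using x by (simp add: R_def)
    define f where "f w = g (s + w) * of_real x powr w" for w
    define U where "U = {w. Re w > - Re s}"
    have U: "open U" "convex U" unfolding U_def by (auto simp: open_halfspace_Re_gt convex_halfspace_Re_gt)
    have sU: "s + w \<in> half_plane 0" if "w \<in> U" for w using that by (simp add: U_def half_plane_def)
    have "(g \<circ> (\<lambda>w. s + w)) holomorphic_on U"
      by (rule holomorphic_on_compose_gen[OF _ hol]) (auto intro!: holomorphic_intros sU)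
    then have f: "f holomorphic_on U"
      unfolding f_def using x by (intro holomorphic_intros) (auto simp: o_def)
    have fbd: "norm (f w) \<le> K * x powr Re w" if "w \<in> U" for w
      using bd[OF sU[OF that]] x by (simp add: f_def norm_mult norm_powr_real_powr mult_right_mono)
    have sub: "{w. -l \<le> Re w \<and> Re w \<le> c} \<subseteq> U" using pos by (auto simp: U_def)
    let ?V = "contour_integral (linepath (Complex c (-R)) (Complex c R)) (\<lambda>w. f w / w)"
    let ?T = "\<lambda>R. contour_integral (linepath (Complex (-l) R) (Complex c R)) (\<lambda>w. f w / w)"
    let ?W = "contour_integral (linepath (Complex (-l) (-R)) (Complex (-l) R)) (\<lambda>w. f w / w)"
    have eq: "?V - 2 * pi * \<i> * f 0 = ?T R - ?T (-R) + ?W"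
      using vertical_integral_residue[OF f U sub pos(1,2) R] .
    have T: "norm (?T r) \<le> K * x powr c / R * (c + l)" if r: "\<bar>r\<bar> = R" for r
    proof -
      let ?seg = "closed_segment (Complex (-l) r) (Complex c r)"
      have seg: "Im w = r \<and> -l \<le> Re w \<and> Re w \<le> c" if "w \<in> ?seg" for w
        using that pos by (auto simp: closed_segment_same_Im closed_segment_eq_real_ivl)
      have "norm (?T r) \<le> K * x powr c / R * norm (Complex c r - Complex (-l) r)"
      proof (rule contour_integral_bound_linepath)
        show "(\<lambda>w. f w / w) contour_integrable_on linepath (Complex (-l) r) (Complex c r)"
          using seg sub r R
          by (intro contour_integrable_continuous_linepath continuous_intros
               continuous_on_subset[OF holomorphic_on_imp_continuous_on[OF f]]) force+
        fix w assume w: "w \<in> ?seg"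
        have "norm (f w) \<le> K * x powr c"
          using fbd[of w] seg[OF w] sub x K0 mult_left_mono[OF powr_mono[of "Re w" c x], of K] by force
        moreover have "R \<le> norm w" using abs_Im_le_cmod[of w] seg[OF w] r by simp
        ultimately show "norm (f w / w) \<le> K * x powr c / R"
          using R K0 by (simp add: norm_divide frac_le)
      qed (use K0 R in auto)
      also have "Complex c r - Complex (-l) r = of_real (c + l)" by (simp add: complex_eq_iff)
      also have "norm \<dots> = c + l" using pos by (simp only: norm_of_real)
      finally show ?thesis .
    qed
    have W: "norm ?W \<le> 2 * (K * x powr -l) * arsinh (R / l)"
    proof (rule vertical_quotient_bound[OF _ pos(1) R])
      show "continuous_on (closed_segment (Complex (-l) (-R)) (Complex (-l) R)) f"
        using sub pos by (intro continuous_on_subset[OF holomorphic_on_imp_continuous_on[OF f]])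
          (auto simp: closed_segment_same_Re)
      show "norm (f w) \<le> K * x powr -l" if "Re w = -l" for w
        using fbd[of w] that pos by (simp add: U_def)
    qed
    have tri: "norm (?T R - ?T (-R) + ?W) \<le> norm (?T R) + norm (?T (-R)) + norm ?W"
      using norm_triangle_ineq[of "?T R - ?T (-R)" ?W] norm_triangle_ineq4[of "?T R" "?T (-R)"] by linarith
    have add3: "X \<le> 2 * p + q" if "X \<le> u + v + w" "u \<le> p" "v \<le> p" "w \<le> q" for X u v w p q :: real
      using that by linarith
    have "norm (?V - 2 * pi * \<i> * f 0) \<le>
        2 * (K * x powr c / R * (c + l)) + 2 * (K * x powr -l) * arsinh (R / l)"
      unfolding eq by (rule add3[OF tri T T W]) (use R in simp_all)
    moreover have "f 0 = g s" using x by (simp add: f_def)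
    ultimately have near_g: "norm (?V - 2 * pi * \<i> * g s) \<le>
        2 * (K * x powr c / R * (c + l)) + 2 * (K * x powr -l) * arsinh (R / l)"
      by simp
    have near_S: "norm (?V - 2 * pi * \<i> * S N) \<le> 4 * (real N + 1) * x powr c / R * A"
      unfolding f_def A_def S_def x_def
      by (rule truncated_perron_series[OF sm conv pos(2,3) R])
    have decomp: "2 * pi * \<i> * (S N - g s) = (?V - 2 * pi * \<i> * g s) - (?V - 2 * pi * \<i> * S N)"
      by (simp add: algebra_simps)
    have "norm (2 * pi * \<i> * (S N - g s)) \<le> norm (?V - 2 * pi * \<i> * g s) + norm (?V - 2 * pi * \<i> * S N)"
      unfolding decomp by (rule norm_triangle_ineq4)
    also have "\<dots> \<le> 2 * (K * x powr c / R * (c + l)) + 2 * (K * x powr -l) * arsinh (R / l) +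
        4 * (real N + 1) * x powr c / R * A"
      by (rule add_mono[OF near_g near_S])
    also have "\<dots> = E N" by (simp add: E_def Let_def x_def R_def)
    finally show ?thesis .
  qed
  have "(\<lambda>N. 4 * (real N + 1) * (real N + 1/2) powr c / (real N + 1/2) powr (c + 2)) \<longlonglongrightarrow> 0"
    "(\<lambda>N. (real N + 1/2) powr c / (real N + 1/2) powr (c + 2)) \<longlonglongrightarrow> 0"
    "(\<lambda>N. (real N + 1/2) powr -l * arsinh ((real N + 1/2) powr (c + 2) / l)) \<longlonglongrightarrow> 0"
    unfolding arsinh_real_def using pos(1,2) by real_asymp+
  note lims = this
  have "(\<lambda>N. 4 * (real N + 1) * (real N + 1/2) powr c / (real N + 1/2) powr (c + 2) * A +
      2 * (K * ((real N + 1/2) powr c / (real N + 1/2) powr (c + 2)) * (c + l)) +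
      2 * (K * ((real N + 1/2) powr -l * arsinh ((real N + 1/2) powr (c + 2) / l)))) \<longlonglongrightarrow>
      0 * A + 2 * (K * 0 * (c + l)) + 2 * (K * 0)"
    by (intro tendsto_intros lims)
  then have "E \<longlonglongrightarrow> 0" by (simp add: E_def[abs_def] Let_def mult.assoc)
  have "(\<lambda>N. 2 * pi * \<i> * (S N - g s)) \<longlonglongrightarrow> 0"
  proof (rule Lim_null_comparison[OF _ \<open>E \<longlonglongrightarrow> 0\<close>])
    show "\<forall>\<^sub>F N in sequentially. norm (2 * pi * \<i> * (S N - g s)) \<le> E N"
      using eventually_ge_at_top[of 1] by eventually_elim (rule le)
  qed
  then have "(\<lambda>N. 2 * pi * \<i> * (S N - g s) / (2 * pi * \<i>)) \<longlonglongrightarrow> 0 / (2 * pi * \<i>)"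
    by (intro tendsto_intros) auto
  then have "(\<lambda>N. S N - g s) \<longlonglongrightarrow> 0" by simp
  then have "S \<longlonglongrightarrow> g s" by (rule LIM_zero_cancel)
  then show "(\<lambda>k. a (Suc k) * of_nat (Suc k) powr (- s)) sums g s"
    unfolding sums_def S_def .
qed

section \<open>The algebra of Dirichlet series\<close>

lemma convex_half_plane: "convex (half_plane \<theta>)"
  unfolding half_plane_def by (rule convex_halfspace_Re_gt)

section \<open>Holomorphy of conditionally convergent Dirichlet series\<close>

lemma abel_summation:
  fixes b u :: "nat \<Rightarrow> 'a::comm_ring"
  shows "(\<Sum>k<n. b k * u k) = (\<Sum>k<n. b k) * u n + (\<Sum>k<n. (\<Sum>j<Suc k. b j) * (u k - u (Suc k)))"
  by (induction n) (simp_all add: algebra_simps)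

text \<open>The mean value inequality gains a factor 1 / (k + 1), which makes the differences
  summable as soon as Re z > 0.\<close>

lemma norm_powr_diff_Suc:
  assumes "Re z \<ge> 0"
  shows "norm (complex_of_nat (Suc k) powr (-z) - of_nat (Suc (Suc k)) powr (-z)) \<le>
    norm z * real (Suc k) powr (- Re z - 1)"
proof -
  let ?S = "closed_segment (complex_of_nat (Suc k)) (of_nat (Suc (Suc k)))"
  have real: "\<exists>x\<ge>real (Suc k). w = of_real x" if "w \<in> ?S" for w
  proof -
    have "w \<in> closed_segment (of_real (real (Suc k))) (of_real (real (Suc (Suc k))))"
      using that by (simp del: of_nat_Suc)
    then obtain x where "w = of_real x" "x \<in> closed_segment (real (Suc k)) (real (Suc (Suc k)))"
      unfolding closed_segment_of_real by blast
    then show ?thesis by (auto simp: closed_segment_eq_real_ivl)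
  qed
  have "norm (complex_of_nat (Suc k) powr (-z) - of_nat (Suc (Suc k)) powr (-z)) \<le>
      norm z * real (Suc k) powr (- Re z - 1) * norm (complex_of_nat (Suc k) - of_nat (Suc (Suc k)))"
  proof (rule field_differentiable_bound[where S = ?S and f' = "\<lambda>w. -z * w powr (-z - 1)"])
    fix w assume "w \<in> ?S"
    then obtain x where x: "x \<ge> real (Suc k)" "w = of_real x" using real by blast
    then have "x > 0" by (simp add: order_less_le_trans[OF _ x(1)])
    then show "((\<lambda>w. w powr (-z)) has_field_derivative -z * w powr (-z - 1)) (at w within ?S)"
      using x by (auto intro!: derivative_eq_intros)
    have "norm (-z * w powr (-z - 1)) = norm z * x powr (- Re z - 1)"
      using \<open>x > 0\<close> x by (simp add: norm_mult norm_powr_real_powr)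
    also have "\<dots> \<le> norm z * real (Suc k) powr (- Re z - 1)"
      using x assms by (intro mult_left_mono powr_mono2') auto
    finally show "norm (-z * w powr (-z - 1)) \<le> norm z * real (Suc k) powr (- Re z - 1)" .
  qed auto
  then show ?thesis by simp
qed

text \<open>Without absolute convergence the terms cannot be dominated directly. Abel summation
  against the bounded partial sums at a point \<delta> further left gives terms of order k powr
  (-\<delta> - 1), hence locally uniform convergence.\<close>

lemma dirichlet_series_holomorphic:
  assumes f: "has_dirichlet_series f a (half_plane 0)"
  shows "f holomorphic_on half_plane 0"
proof -
  have "\<exists>r>0. f holomorphic_on ball z r" if z: "z \<in> half_plane 0" for z
  proof -
    \<comment> \<open>On the ball of radius \<delta>, \<open>Re s\<close> is at least 2 * \<delta>,
      so \<open>s\<close> stays at least \<delta> to the right of the reference point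
      \<delta>.\<close>
    define \<delta> where "\<delta> = Re z / 3"
    have \<delta>: "\<delta> > 0" using z by (simp add: \<delta>_def half_plane_def)
    define b where "b k = a (Suc k) * of_nat (Suc k) powr (- of_real \<delta>)" for k
    define u where "u k s = (of_nat (Suc k) :: complex) powr (- (s - of_real \<delta>))" for k s
    have "b sums f (of_real \<delta>)"
      using f \<delta> unfolding has_dirichlet_series_def half_plane_def b_def[abs_def] by simp
    then have "convergent (\<lambda>n. \<Sum>k<n. b k)" unfolding sums_def by (rule convergentI)
    then have "Bseq (\<lambda>n. \<Sum>k<n. b k)" by (rule convergent_imp_Bseq)
    then obtain C where C: "C > 0" "\<And>n. norm (\<Sum>k<n. b k) \<le> C"
      unfolding Bseq_def by blast
    let ?g = "\<lambda>k s. (\<Sum>j<Suc k. b j) * (u k s - u (Suc k) s)"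
    have ball: "Re (s - of_real \<delta>) \<ge> \<delta>" "norm (s - of_real \<delta>) \<le> norm z + 2 * \<delta>" if "s \<in> ball z \<delta>" for s
    proof -
      have d: "norm (z - s) < \<delta>" using that by (simp add: dist_norm)
      then show "Re (s - of_real \<delta>) \<ge> \<delta>"
        using abs_Re_le_cmod[of "z - s"] by (simp add: \<delta>_def)
      have "norm (s - of_real \<delta>) \<le> norm s + norm (complex_of_real \<delta>)" by (rule norm_triangle_ineq4)
      moreover have "norm s \<le> norm z + norm (z - s)" by norm
      ultimately show "norm (s - of_real \<delta>) \<le> norm z + 2 * \<delta>" using d \<delta> by simp
    qed
    have unif: "uniform_limit (ball z \<delta>) (\<lambda>n s. \<Sum>k<n. ?g k s) (\<lambda>s. \<Sum>k. ?g k s) sequentially"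
    proof (rule Weierstrass_m_test)
      show "norm (?g k s) \<le> C * (norm z + 2 * \<delta>) * real (Suc k) powr (- \<delta> - 1)" if "s \<in> ball z \<delta>" for k s
      proof -
        have "norm (u k s - u (Suc k) s) \<le> norm (s - of_real \<delta>) * real (Suc k) powr (- Re (s - of_real \<delta>) - 1)"
          unfolding u_def using ball(1)[OF that] \<delta> by (intro norm_powr_diff_Suc) linarith
        also have "\<dots> \<le> (norm z + 2 * \<delta>) * real (Suc k) powr (- \<delta> - 1)"
          using ball[OF that] \<delta> by (intro mult_mono powr_mono) auto
        finally have "norm (\<Sum>j<Suc k. b j) * norm (u k s - u (Suc k) s) \<le>
            C * ((norm z + 2 * \<delta>) * real (Suc k) powr (- \<delta> - 1))"
          using C by (intro mult_mono) (auto simp del: sum.lessThan_Suc)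
        then show ?thesis by (simp only: norm_mult mult.assoc)
      qed
      have "summable (\<lambda>k. real (Suc k) powr (- \<delta> - 1))"
        using \<delta> by (subst summable_Suc_iff[of "\<lambda>k. real k powr (- \<delta> - 1)"]) (simp add: summable_real_powr_iff)
      then show "summable (\<lambda>k. C * (norm z + 2 * \<delta>) * real (Suc k) powr (- \<delta> - 1))"
        by (rule summable_mult)
    qed
    have sums: "(\<lambda>k. ?g k s) sums f s" if s: "s \<in> ball z \<delta>" for s
    proof -
      have "Re s > 0" using ball(1)[OF s] \<delta> by simp
      then have "(\<lambda>k. a (Suc k) * of_nat (Suc k) powr (-s)) sums f s"
        using f unfolding has_dirichlet_series_def half_plane_def by simp
      moreover have "a (Suc k) * of_nat (Suc k) powr (-s) = b k * u k s" for k
        by (simp add: b_def u_def mult.assoc powr_add[symmetric] del: of_nat_Suc)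
      ultimately have conv: "(\<lambda>n. \<Sum>k<n. b k * u k s) \<longlonglongrightarrow> f s" by (simp add: sums_def)
      \<comment> \<open>The boundary term of the Abel summation.\<close>
      have "(\<lambda>n. (\<Sum>k<n. b k) * u n s) \<longlonglongrightarrow> 0"
      proof (rule Lim_null_comparison)
        have "norm ((\<Sum>k<n. b k) * u n s) \<le> C * real (Suc n) powr - \<delta>" for n
        proof -
          have "norm (u n s) = real (Suc n) powr (- Re (s - of_real \<delta>))"
            using norm_powr_real_powr[of "of_nat (Suc n)" "- (s - of_real \<delta>)"] by (simp add: u_def del: of_nat_Suc)
          also have "\<dots> \<le> real (Suc n) powr - \<delta>" using ball(1)[OF s] by (intro powr_mono) auto
          finally show ?thesis unfolding norm_mult using C by (intro mult_mono) auto
        qed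
        then show "\<forall>\<^sub>F n in sequentially. norm ((\<Sum>k<n. b k) * u n s) \<le> C * real (Suc n) powr - \<delta>" by simp
        show "(\<lambda>n. C * real (Suc n) powr - \<delta>) \<longlonglongrightarrow> 0" using \<delta> C by real_asymp
      qed
      from tendsto_diff[OF conv this] show ?thesis
        unfolding sums_def by (subst (asm) abel_summation) simp
    qed
    have "f holomorphic_on ball z \<delta>"
    proof (rule holomorphic_uniform_sequence[OF open_ball])
      show "(\<lambda>s. \<Sum>k<n. ?g k s) holomorphic_on ball z \<delta>" for n
        unfolding u_def by (intro holomorphic_intros)
      fix x assume "x \<in> ball z \<delta>"
      then obtain d where d: "d > 0" "cball x d \<subseteq> ball z \<delta>"
        using open_contains_cball[of "ball z \<delta>"] open_ball by blast
      have "uniform_limit (ball z \<delta>) (\<lambda>n s. \<Sum>k<n. ?g k s) f sequentially"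
        using unif by (rule uniform_limit_cong'[THEN iffD1, rotated -1]) (use sums in \<open>auto simp: sums_iff\<close>)
      then show "\<exists>d>0. cball x d \<subseteq> ball z \<delta> \<and> uniform_limit (cball x d) (\<lambda>n s. \<Sum>k<n. ?g k s) f sequentially"
        using d uniform_limit_on_subset by blast
    qed
    then show ?thesis using \<delta> by blast
  qed
  then have "f analytic_on half_plane 0" unfolding analytic_on_def by blast
  then show ?thesis by (rule analytic_imp_holomorphic)
qed

section \<open>Boundedness and uniform continuity\<close>

lemma dirichlet_algebra_limit:
  assumes "f \<in> dirichlet_algebra" "\<epsilon> > 0"
  obtains b M where "M > 0" "\<And>s. Re s \<ge> M \<Longrightarrow> norm (f s - b) \<le> \<epsilon>"
proof -
  obtain a where "has_dirichlet_series f a (half_plane 0)"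
    using assms unfolding dirichlet_algebra_def by blast
  then obtain B where "abs_dirichlet (power_denom 1) (0 + 3) B f"
    using dirichlet_series_abs_dirichlet by blast
  then obtain b where "\<And>\<epsilon>. \<epsilon> > 0 \<Longrightarrow> \<exists>\<sigma>\<ge>0 + 3. abs_dirichlet (power_denom 1) \<sigma> \<epsilon> (\<lambda>s. f s - b)"
    using abs_dirichlet_constant_term by blast
  then obtain \<sigma> where \<sigma>: "\<sigma> \<ge> 0 + 3" "abs_dirichlet (power_denom 1) \<sigma> \<epsilon> (\<lambda>s. f s - b)"
    using \<open>\<epsilon> > 0\<close> by blast
  show ?thesis
  proof (rule that[of \<sigma> b])
    show "norm (f s - b) \<le> \<epsilon>" if "Re s \<ge> \<sigma>" for s
      using abs_dirichlet_bound[OF \<sigma>(2) power_denom_subset that] .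
  qed (use \<sigma> in simp)
qed

lemma dirichlet_algebra_bounded:
  assumes f: "f \<in> dirichlet_algebra"
  shows "\<exists>K. \<forall>s\<in>half_plane 0. norm (f s) \<le> K"
proof -
  obtain b M where M: "M > 0" "\<And>s. Re s \<ge> M \<Longrightarrow> norm (f s - b) \<le> 1"
    using dirichlet_algebra_limit[OF f zero_less_one] by blast
  have "uniformly_continuous_on (half_plane 0) f" using f by (simp add: dirichlet_algebra_def)
  then obtain \<delta> where \<delta>: "\<delta> > 0"
    "\<And>s s'. s \<in> half_plane 0 \<Longrightarrow> s' \<in> half_plane 0 \<Longrightarrow> dist s' s < \<delta> \<Longrightarrow> dist (f s') (f s) < 1"
    unfolding uniformly_continuous_on_def by (metis zero_less_one)
  define d where "d = \<delta> / 2"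
  have d: "0 < d" "d < \<delta>" using \<delta> by (auto simp: d_def)
  \<comment> \<open>Each step to the right changes \<open>f\<close> by less than 1, and the number
    of steps needed to pass \<open>M\<close> does not depend on \<open>s\<close>.\<close>
  have steps: "norm (f s - f (s + of_real (real j * d))) \<le> real j" if "s \<in> half_plane 0" for s j
  proof (induction j)
    case (Suc j)
    let ?x = "s + of_real (real j * d)" and ?y = "s + of_real (real (Suc j) * d)"
    have "?x \<in> half_plane 0" "?y \<in> half_plane 0" using that d by (auto simp: half_plane_def add_pos_nonneg)
    moreover have "dist ?x ?y = d"
    proof -
      have "?x - ?y = of_real (- d)" by (simp add: algebra_simps)
      then show ?thesis using d by (simp only: dist_norm norm_of_real)
    qed
    ultimately have "norm (f ?x - f ?y) < 1" using \<delta>(2)[of ?y ?x] d by (simp add: dist_norm)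
    moreover have "norm (f s - f ?y) \<le> norm (f s - f ?x) + norm (f ?x - f ?y)" by norm
    ultimately show ?case using Suc by simp
  qed simp
  define N where "N = nat \<lceil>M / d\<rceil>"
  have "real N \<ge> M / d" unfolding N_def by linarith
  then have N: "real N * d \<ge> M" using d by (simp add: field_simps)
  have "norm (f s) \<le> real N + norm b + 1" if s: "s \<in> half_plane 0" for s
  proof -
    let ?y = "s + of_real (real N * d)"
    have "norm (f ?y - b) \<le> 1" using s N by (intro M(2)) (simp add: half_plane_def)
    moreover have "norm (f s) \<le> norm (f s - f ?y) + norm (f ?y - b) + norm b" by norm
    ultimately show ?thesis using steps[OF s, of N] by linarith
  qed
  then show ?thesis by blast
qed

lemma uniformly_continuous_on_compose_dirichlet_algebra:
  assumes f: "f \<in> dirichlet_algebra" and cont: "continuous_on (half_plane 0) \<Phi>"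
    and im: "\<Phi> ` half_plane 0 \<subseteq> half_plane 0"
    and uc: "\<And>M. M > 0 \<Longrightarrow> uniformly_continuous_on {s\<in>half_plane 0. 0 < Re (\<Phi> s) \<and> Re (\<Phi> s) < M} \<Phi>"
  shows "uniformly_continuous_on (half_plane 0) (f \<circ> \<Phi>)"
  unfolding uniformly_continuous_on_def
proof (intro allI impI)
  fix \<epsilon> :: real assume \<epsilon>: "\<epsilon> > 0"
  obtain b M where M: "M > 0" "\<And>s. Re s \<ge> M \<Longrightarrow> norm (f s - b) \<le> \<epsilon> / 4"
    by (rule dirichlet_algebra_limit[OF f, of "\<epsilon> / 4"]) (use \<epsilon> that in auto)
  have far: "dist (f w) (f w') \<le> \<epsilon> / 2" if "Re w \<ge> M" "Re w' \<ge> M" for w w'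
  proof -
    have "dist (f w) (f w') \<le> norm (f w - b) + norm (f w' - b)" unfolding dist_norm by norm
    then show ?thesis using M(2)[OF that(1)] M(2)[OF that(2)] by linarith
  qed
  have "uniformly_continuous_on (half_plane 0) f" using f by (simp add: dirichlet_algebra_def)
  moreover have "\<epsilon> / 2 > 0" using \<epsilon> by simp
  ultimately obtain \<eta> where \<eta>: "\<eta> > 0"
    "\<And>w w'. w \<in> half_plane 0 \<Longrightarrow> w' \<in> half_plane 0 \<Longrightarrow> dist w' w < \<eta> \<Longrightarrow> dist (f w') (f w) < \<epsilon> / 2"
    unfolding uniformly_continuous_on_def by metis
  \<comment> \<open>The bound is M + 1 rather than M, so that points with Re \<Phi> = M belong to
    \<open>A\<close>.\<close>
  define A where "A = {s\<in>half_plane 0. 0 < Re (\<Phi> s) \<and> Re (\<Phi> s) < M + 1}"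
  have "uniformly_continuous_on A \<Phi>" unfolding A_def using M by (intro uc) auto
  then obtain \<delta> where \<delta>: "\<delta> > 0" "\<And>s s'. s \<in> A \<Longrightarrow> s' \<in> A \<Longrightarrow> dist s' s < \<delta> \<Longrightarrow> dist (\<Phi> s') (\<Phi> s) < \<eta>"
    unfolding uniformly_continuous_on_def using \<eta>(1) by metis
  have \<Phi>0: "\<Phi> s \<in> half_plane 0" if "s \<in> half_plane 0" for s using im that by auto
  have inA: "s \<in> A \<longleftrightarrow> Re (\<Phi> s) < M + 1" if "s \<in> half_plane 0" for s
    using \<Phi>0[OF that] that by (auto simp: A_def half_plane_def)
  have near: "dist (f (\<Phi> s')) (f (\<Phi> s)) < \<epsilon> / 2" if "s \<in> A" "s' \<in> A" "dist s' s < \<delta>" for s s'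
    using \<eta>(2)[OF \<Phi>0 \<Phi>0 \<delta>(2)[OF that]] that by (auto simp: A_def)
  have mixed: "dist (f (\<Phi> s')) (f (\<Phi> s)) < \<epsilon>"
    if s: "s \<in> half_plane 0" "s' \<in> half_plane 0" and d: "dist s' s < \<delta>" and le: "Re (\<Phi> s) \<le> Re (\<Phi> s')" for s s'
  proof -
    consider "Re (\<Phi> s') < M + 1" | "Re (\<Phi> s) \<ge> M" | "Re (\<Phi> s) < M" "Re (\<Phi> s') \<ge> M"
      by linarith
    then show ?thesis
    proof cases
      case 1
      then have "s \<in> A" "s' \<in> A" using inA s le by auto
      then show ?thesis using near[OF _ _ d] \<epsilon> by fastforce
    next
      case 2
      then show ?thesis using far[of "\<Phi> s'" "\<Phi> s"] le \<epsilon> by simp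
    next
      case 3
      have seg: "closed_segment s s' \<subseteq> half_plane 0"
        using s convex_half_plane by (intro closed_segment_subset) auto
      \<comment> \<open>Here \<Phi> s' may be arbitrarily far away. The intermediate value theorem
        gives a point \<open>z\<close> between with Re \<Phi> z = M: from \<open>s\<close> to
        \<open>z\<close> uniform continuity on \<open>A\<close> applies, and from \<open>z\<close>
        to \<open>s'\<close> the function \<open>f\<close> is almost constant.\<close>
      have "continuous_on {0..1} (\<lambda>t. Re (\<Phi> (linepath s s' t)))"
        using seg by (intro continuous_intros continuous_on_compose2[OF cont])
          (auto simp: linepath_image_01 intro: subsetD[OF seg] linepath_in_path)
      then obtain t where t: "0 \<le> t" "t \<le> 1" "Re (\<Phi> (linepath s s' t)) = M"
        using IVT'[of "\<lambda>t. Re (\<Phi> (linepath s s' t))" 0 M 1] 3 by (auto simp: linepath_0' linepath_1')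
      define z where "z = linepath s s' t"
      have z: "z \<in> closed_segment s s'" using t by (auto simp: z_def intro: linepath_in_path)
      have "dist z s \<le> dist s' s" using segment_bound(1)[OF z] by (simp add: dist_norm)
      then have "dist (f (\<Phi> z)) (f (\<Phi> s)) < \<epsilon> / 2"
        using 3 t s z seg d inA by (intro near) (auto simp: z_def)
      moreover have "dist (f (\<Phi> s')) (f (\<Phi> z)) \<le> \<epsilon> / 2"
        using 3 t by (intro far) (auto simp: z_def)
      ultimately show ?thesis
        using dist_triangle[of "f (\<Phi> s')" "f (\<Phi> s)" "f (\<Phi> z)"] by linarith
    qed
  qed
  show "\<exists>d>0. \<forall>x\<in>half_plane 0. \<forall>x'\<in>half_plane 0. dist x' x < d \<longrightarrow> dist ((f \<circ> \<Phi>) x') ((f \<circ> \<Phi>) x) < \<epsilon>"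
  proof (intro exI[of _ \<delta>] conjI ballI impI)
    fix x y assume "x \<in> half_plane 0" "y \<in> half_plane 0" "dist y x < \<delta>"
    then show "dist ((f \<circ> \<Phi>) y) ((f \<circ> \<Phi>) x) < \<epsilon>"
      using mixed[of x y] mixed[of y x] by (cases "Re (\<Phi> x) \<le> Re (\<Phi> y)") (auto simp: dist_commute)
  qed (rule \<delta>(1))
qed

section \<open>Composition\<close>

text \<open>The leading term of \<phi> - b is a negative real number at some point of a vertical
  line, and there Re \<phi> \<le> Re b. The correction \<open>1 + h\<close> has positive real part
  and cannot reverse the sign.\<close>

lemma abs_dirichlet_constant_term_pos:
  assumes \<phi>: "abs_dirichlet (power_denom 1) \<sigma>0 B \<phi>" and pos: "\<And>s. Re s \<ge> \<sigma>0 \<Longrightarrow> Re (\<phi> s) > 0"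
    and b: "\<And>\<epsilon>. \<epsilon> > 0 \<Longrightarrow> \<exists>\<sigma>\<ge>\<sigma>0. abs_dirichlet (power_denom 1) \<sigma> \<epsilon> (\<lambda>s. \<phi> s - b)"
  shows "Re b > 0"
proof -
  obtain \<sigma>1 where \<sigma>1: "\<sigma>1 \<ge> \<sigma>0" "abs_dirichlet (power_denom 1) \<sigma>1 1 (\<lambda>s. \<phi> s - b)"
    using b[of 1] by auto
  show ?thesis
  proof (cases "\<phi> (of_real \<sigma>1) - b = 0")
    case True
    then show ?thesis using pos[of "of_real \<sigma>1"] \<sigma>1 by simp
  next
    case False
    then obtain m a \<sigma> h where h: "m \<ge> 1" "a \<noteq> 0" "\<sigma> \<ge> \<sigma>1" "abs_dirichlet (power_denom m) \<sigma> (1/2) h"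
      and eq: "\<And>s. Re s \<ge> \<sigma> \<Longrightarrow> \<phi> s - b = a * of_nat m powr (-s) * (1 + h s)"
      by (rule abs_dirichlet_leading_term[OF \<sigma>1(2), of "of_real \<sigma>1" "1/2"]) (auto intro: that)
    have h2: "Re (1 + h s) \<ge> 1/2" if "Re s \<ge> \<sigma>" for s
      using abs_dirichlet_bound[OF h(4) power_denom_subset that] abs_Re_le_cmod[of "h s"] by simp
    \<comment> \<open>For \<open>m = 1\<close> the leading term would be a nonzero constant,
      although \<phi> - b tends to 0.\<close>
    have "m \<noteq> 1"
    proof
      assume m: "m = 1"
      obtain \<tau> where \<tau>: "\<tau> \<ge> \<sigma>0" "abs_dirichlet (power_denom 1) \<tau> (norm a / 4) (\<lambda>s. \<phi> s - b)"
        using b[of "norm a / 4"] h(2) by auto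
      define s where "s = complex_of_real (max \<sigma> \<tau>)"
      have "norm (\<phi> s - b) \<le> norm a / 4"
        by (rule abs_dirichlet_bound[OF \<tau>(2) power_denom_subset]) (simp add: s_def)
      moreover have "\<phi> s - b = a * (1 + h s)" using eq[of s] m by (simp add: s_def)
      moreover have "norm (1 + h s) \<ge> 1/2"
        using h2[of s] complex_Re_le_cmod[of "1 + h s"] by (simp add: s_def)
      then have "norm a * norm (1 + h s) \<ge> norm a * (1/2)" by (intro mult_left_mono) auto
      moreover have "norm a > 0" using h(2) by simp
      ultimately show False by (simp add: norm_mult)
    qed
    then have lnm: "ln (real m) > 0" using h(1) by simp
    \<comment> \<open>the height \<open>t\<close> is chosen so that the leading term is a negative real number\<close>
    define t where "t = (Arg a + pi) / ln (real m)"
    define s where "s = Complex \<sigma> t"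
    have "of_nat m powr (-s) = of_real (real m powr -\<sigma>) * cis (- Arg a - pi)"
    proof -
      have "of_nat m powr (-s) = exp (of_real (- \<sigma> * ln (real m)) + \<i> * of_real (- t * ln (real m)))"
        using h(1) by (simp add: of_nat_powr_eq_exp s_def Complex_eq algebra_simps)
      also have "- t * ln (real m) = - Arg a - pi" using lnm by (simp add: t_def)
      also have "exp (complex_of_real (- \<sigma> * ln (real m)) + \<i> * of_real (- Arg a - pi)) =
          of_real (exp (- \<sigma> * ln (real m))) * cis (- Arg a - pi)"
        by (simp only: exp_add exp_of_real cis_conv_exp)
      also have "exp (- \<sigma> * ln (real m)) = real m powr -\<sigma>"
        using h(1) by (simp add: powr_def)
      finally show ?thesis .
    qed
    moreover have "a = of_real (norm a) * cis (Arg a)"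
      using rcis_cmod_Arg[of a] by (simp add: rcis_def)
    then have "a * cis (- Arg a - pi) = of_real (norm a) * (cis (Arg a) * cis (- Arg a - pi))"
      by (metis mult.assoc)
    then have "a * cis (- Arg a - pi) = - of_real (norm a)"
      by (simp add: cis_mult) (simp add: complex_eq_iff)
    ultimately have "a * of_nat m powr (-s) = of_real (- (norm a * real m powr -\<sigma>))"
      by (simp add: mult.left_commute[of a])
    then have "\<phi> s - b = of_real (- (norm a * real m powr -\<sigma>)) * (1 + h s)"
      using eq[of s] by (simp add: s_def)
    then have "Re (\<phi> s - b) = - (norm a * real m powr -\<sigma>) * Re (1 + h s)"
      by (simp only: Re_complex_of_real Im_complex_of_real times_complex.sel)
    moreover have "norm a * real m powr -\<sigma> * Re (1 + h s) \<ge> 0"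
      using h2[of s] h by (intro mult_nonneg_nonneg) (auto simp: s_def)
    ultimately have "Re (\<phi> s) \<le> Re b" by simp
    moreover have "Re (\<phi> s) > 0" using pos[of s] h \<sigma>1 by (simp add: s_def)
    ultimately show ?thesis by linarith
  qed
qed

text \<open>Each n powr (-\<Phi> s) is (n ^ c) powr (-s) * exp (- ln n * \<phi> s), of norm at most
  n powr (B - c * \<sigma>). With c \<ge> 1 and \<sigma> \<ge> B + 3 the exponent is at most -3,
  where the coefficients of \<open>f\<close> are absolutely summable.\<close>

lemma abs_dirichlet_compose_linear:
  fixes c :: nat
  assumes f: "has_dirichlet_series f a (half_plane 0)" and c: "c \<ge> 1"
    and \<phi>: "abs_dirichlet (power_denom 1) \<sigma>0 B \<phi>"
    and \<Phi>: "\<And>s. Re s \<ge> \<sigma>0 \<Longrightarrow> \<Phi> s = of_nat c * s + \<phi> s" "\<And>s. Re s \<ge> \<sigma>0 \<Longrightarrow> \<Phi> s \<in> half_plane 0"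
  shows "\<exists>\<sigma> B. abs_dirichlet (power_denom 1) \<sigma> B (f \<circ> \<Phi>)"
proof -
  define \<sigma> where "\<sigma> = max \<sigma>0 (max 0 (B + 3))"
  have \<sigma>: "\<sigma> \<ge> \<sigma>0" "\<sigma> \<ge> 0" "\<sigma> \<ge> B + 3" by (auto simp: \<sigma>_def)
  have \<phi>\<sigma>: "abs_dirichlet (power_denom 1) \<sigma> B \<phi>"
    using abs_dirichlet_mono[OF \<phi> _ _ \<sigma>(1)] power_denom_subset by blast
  define F where "F k s = a (Suc k) * of_real (real (Suc k ^ c)) powr (-s) *
      exp (of_real (- ln (real (Suc k))) * \<phi> s)" for k s
  let ?B = "\<lambda>k. norm (a (Suc k)) * real (Suc k ^ c) powr -\<sigma> * exp (norm (complex_of_real (- ln (real (Suc k)))) * B)"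
  have "abs_dirichlet (power_denom 1) \<sigma> (suminf ?B) (f \<circ> \<Phi>)"
  proof (rule abs_dirichlet_sums)
    show "abs_dirichlet (power_denom 1) \<sigma> (?B k) (F k)" for k
      unfolding F_def
      by (intro abs_dirichlet_mult abs_dirichlet_term abs_dirichlet_exp abs_dirichlet_cmult \<phi>\<sigma>
          frequency_monoid_power_denom power_denom_subset order_refl)
        (auto simp: power_denom_Suc_0 simp del: of_nat_Suc of_nat_power intro!: one_le_power)
    show "summable ?B"
    proof (rule summable_comparison_test')
      show "summable (\<lambda>k. norm (a (Suc k)) * real (Suc k) powr -(0 + 3))"
        by (rule dirichlet_series_abs_summable[OF f])
      show "norm (?B k) \<le> norm (a (Suc k)) * real (Suc k) powr -(0 + 3)" if "k \<ge> 0" for k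
      proof -
        have "exp (norm (complex_of_real (- ln (real (Suc k)))) * B) = real (Suc k) powr B"
          unfolding norm_of_real by (simp add: powr_def mult.commute del: of_nat_Suc)
        moreover have "real (Suc k ^ c) powr -\<sigma> = real (Suc k) powr (- (real c * \<sigma>))"
          by (simp add: powr_powr powr_realpow[symmetric] del: of_nat_Suc)
        ultimately have "?B k = norm (a (Suc k)) * real (Suc k) powr (- (real c * \<sigma>) + B)"
          by (simp only: powr_add mult.assoc)
        also have "\<dots> \<le> norm (a (Suc k)) * real (Suc k) powr -(0 + 3)"
        proof (intro mult_left_mono powr_mono)
          have "1 * \<sigma> \<le> real c * \<sigma>" using c \<sigma>(2) by (intro mult_right_mono) auto
          then show "- (real c * \<sigma>) + B \<le> -(0 + 3)" using \<sigma>(3) by linarith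
        qed auto
        finally show ?thesis by (simp only: real_norm_def abs_mult abs_norm_cancel abs_of_nonneg powr_ge_zero abs_exp_cancel)
      qed
    qed
    fix s assume s: "Re s \<ge> \<sigma>"
    then have s0: "Re s \<ge> \<sigma>0" using \<sigma> by linarith
    have "a (Suc k) * of_nat (Suc k) powr (- \<Phi> s) = F k s" for k
    proof -
      have "F k s = a (Suc k) * (of_nat (Suc k ^ c) powr (-s) * exp (of_real (- ln (real (Suc k))) * \<phi> s))"
        by (simp only: F_def of_real_of_nat_eq mult.assoc)
      also have "of_nat (Suc k ^ c) powr (-s) * exp (of_real (- ln (real (Suc k))) * \<phi> s) =
          exp (- \<Phi> s * of_real (ln (real (Suc k))))"
      proof -
        have "ln (real (Suc k ^ c)) = real c * ln (real (Suc k))"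
          by (simp add: ln_realpow del: of_nat_Suc)
        then have "(of_nat (Suc k ^ c) :: complex) powr (-s) = exp (-s * of_real (real c * ln (real (Suc k))))"
          using of_nat_powr_eq_exp[of "Suc k ^ c" "-s"] by (simp only: one_le_power le_add1 Suc_eq_plus1_left)
        then show ?thesis
          by (simp add: \<Phi>(1)[OF s0] exp_add[symmetric] algebra_simps del: of_nat_Suc of_nat_power)
      qed
      also have "\<dots> = of_nat (Suc k) powr (- \<Phi> s)" by (simp add: of_nat_powr_eq_exp del: of_nat_Suc)
      finally show ?thesis by simp
    qed
    moreover have "(\<lambda>k. a (Suc k) * of_nat (Suc k) powr (- \<Phi> s)) sums f (\<Phi> s)"
      using f \<Phi>(2)[OF s0] unfolding has_dirichlet_series_def by blast
    ultimately show "(\<lambda>k. F k s) sums (f \<circ> \<Phi>) s" by simp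
  qed (rule power_denom_subset)
  then show ?thesis by blast
qed

text \<open>
  The series of \<open>f\<close> need not converge absolutely near the limit \<open>b\<close> of \<open>\<phi>\<close> at infinity, so the
  Taylor expansion of \<open>f\<close> at \<open>b\<close> is used instead.
\<close>

lemma abs_dirichlet_compose_bounded:
  assumes f: "f holomorphic_on half_plane 0"
    and \<phi>: "abs_dirichlet (power_denom 1) \<sigma>0 B \<phi>" and pos: "\<And>s. Re s \<ge> \<sigma>0 \<Longrightarrow> Re (\<phi> s) > 0"
  shows "\<exists>\<sigma> B. abs_dirichlet (power_denom 1) \<sigma> B (f \<circ> \<phi>)"
proof -
  obtain b where b: "\<And>\<epsilon>. \<epsilon> > 0 \<Longrightarrow> \<exists>\<sigma>\<ge>\<sigma>0. abs_dirichlet (power_denom 1) \<sigma> \<epsilon> (\<lambda>s. \<phi> s - b)"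
    using abs_dirichlet_constant_term[OF \<phi>] by blast
  have "Re b > 0" by (rule abs_dirichlet_constant_term_pos[OF \<phi> pos b])
  define r where "r = Re b / 2"
  have r: "r > 0" "r < Re b" using \<open>Re b > 0\<close> by (auto simp: r_def)
  obtain \<sigma> where \<sigma>: "\<sigma> \<ge> \<sigma>0" "abs_dirichlet (power_denom 1) \<sigma> r (\<lambda>s. \<phi> s - b)"
    using b[OF r(1)] by blast
  have "ball b (Re b) \<subseteq> half_plane 0"
  proof
    fix w assume "w \<in> ball b (Re b)"
    then show "w \<in> half_plane 0"
      using abs_Re_le_cmod[of "b - w"] by (simp add: half_plane_def dist_norm)
  qed
  then have "f holomorphic_on ball b (Re b)" using f holomorphic_on_subset by blast
  note taylor = holomorphic_power_series[OF this]
  define d where "d k = (deriv ^^ k) f b / fact k" for k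
  \<comment> \<open>A distance strictly between r and Re b = 2 * r: convergence there gives absolute
    convergence at r, the norm bound for \<phi> - b.\<close>
  have "b + of_real (3 * r / 2) \<in> ball b (Re b)"
    using r unfolding mem_ball dist_norm by (simp add: r_def norm_mult)
  from taylor[OF this] have "summable (\<lambda>k. d k * of_real (3 * r / 2) ^ k)"
    by (simp add: d_def sums_iff)
  then have "summable (\<lambda>k. norm (d k * of_real r ^ k))"
    by (rule powser_insidea) (use r in \<open>simp add: norm_mult norm_divide\<close>)
  then have "summable (\<lambda>k. norm (d k) * r ^ k)"
    using r by (simp add: norm_mult norm_power)
  moreover have "(\<lambda>k. d k * (\<phi> s - b) ^ k) sums (f \<circ> \<phi>) s" if "Re s \<ge> \<sigma>" for s
  proof -
    have "norm (\<phi> s - b) \<le> r" by (rule abs_dirichlet_bound[OF \<sigma>(2) power_denom_subset that])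
    then have "\<phi> s \<in> ball b (Re b)" using r by (simp add: dist_norm norm_minus_commute)
    from taylor[OF this] show ?thesis by (simp add: d_def)
  qed
  ultimately show ?thesis
    using abs_dirichlet_power_series[OF \<sigma>(2) frequency_monoid_power_denom] by blast
qed

lemma dirichlet_algebra_compose:
  assumes \<Phi>: "\<Phi> \<in> G_algebra" and f: "f \<in> dirichlet_algebra"
  shows "f \<circ> \<Phi> \<in> dirichlet_algebra"
proof -
  have G: "\<Phi> \<in> G_infinity" and uc: "\<And>M. M > 0 \<Longrightarrow>
      uniformly_continuous_on {s\<in>half_plane 0. 0 < Re (\<Phi> s) \<and> Re (\<Phi> s) < M} \<Phi>"
    using \<Phi> unfolding G_algebra_def by auto
  from G obtain c \<phi> where an: "\<Phi> analytic_on half_plane 0" and im: "\<Phi> ` half_plane 0 \<subseteq> half_plane 0"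
    and \<phi>: "\<phi> \<in> dirichlet_fun" and lin: "\<And>s. s \<in> half_plane 0 \<Longrightarrow> \<Phi> s = of_nat c * s + \<phi> s"
    unfolding G_infinity_def by blast
  have hol: "\<Phi> holomorphic_on half_plane 0" using an by (rule analytic_imp_holomorphic)
  obtain a where a: "has_dirichlet_series f a (half_plane 0)"
    using f unfolding dirichlet_algebra_def by blast
  obtain a' \<theta> where \<theta>: "\<theta> \<ge> 0" "has_dirichlet_series \<phi> a' (half_plane \<theta>)"
    using \<phi> unfolding dirichlet_fun_def by blast
  obtain B where B: "abs_dirichlet (power_denom 1) (\<theta> + 3) B \<phi>"
    using dirichlet_series_abs_dirichlet[OF \<theta>(2)] by blast
  have in0: "s \<in> half_plane 0" if "Re s \<ge> \<theta> + 3" for s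
    using that \<theta> by (simp add: half_plane_def)
  have \<Phi>0: "\<Phi> s \<in> half_plane 0" if "s \<in> half_plane 0" for s using im that by auto
  have "\<exists>\<sigma> C. abs_dirichlet (power_denom 1) \<sigma> C (f \<circ> \<Phi>)"
  \<comment> \<open>For c = 0 the values of \<Phi> gather near a finite limit, for c \<ge> 1 their
    real parts tend to infinity; only in the second case can the series of \<open>f\<close> be used
    directly.\<close>
  proof (cases "c = 0")
    case True
    then have "abs_dirichlet (power_denom 1) (\<theta> + 3) B \<Phi>"
      using abs_dirichlet_cong[OF B] lin in0 by simp
    then show ?thesis
      using \<Phi>0 in0 by (intro abs_dirichlet_compose_bounded dirichlet_series_holomorphic[OF a])
        (auto simp: half_plane_def)
  next
    case False
    then show ?thesis
      using lin in0 \<Phi>0 by (intro abs_dirichlet_compose_linear[OF a _ B, of c]) auto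
  qed
  then obtain \<sigma> C where "abs_dirichlet (power_denom 1) \<sigma> C (f \<circ> \<Phi>)" by blast
  then obtain d where d: "summable (\<lambda>k. norm (d (Suc k)) * real (Suc k) powr -\<sigma>)"
    "\<And>s. Re s \<ge> \<sigma> \<Longrightarrow> (\<lambda>k. d (Suc k) * of_nat (Suc k) powr (- s)) sums (f \<circ> \<Phi>) s"
    by (rule abs_dirichlet_dirichlet_series) (rule that)
  obtain K where K: "\<forall>s\<in>half_plane 0. norm (f s) \<le> K"
    using dirichlet_algebra_bounded[OF f] by blast
  have "has_dirichlet_series (f \<circ> \<Phi>) d (half_plane 0)"
  proof (rule bohr_convergence[OF _ _ d])
    show "(f \<circ> \<Phi>) holomorphic_on half_plane 0"
      by (rule holomorphic_on_compose_gen[OF hol dirichlet_series_holomorphic[OF a] im])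
    show "norm ((f \<circ> \<Phi>) s) \<le> K" if "s \<in> half_plane 0" for s
      using K \<Phi>0[OF that] by simp
  qed
  moreover have "uniformly_continuous_on (half_plane 0) (f \<circ> \<Phi>)"
    by (rule uniformly_continuous_on_compose_dirichlet_algebra
        [OF f holomorphic_on_imp_continuous_on[OF hol] im uc])
  ultimately show ?thesis unfolding dirichlet_algebra_def by blast
qed

lemma half_plane_norm_compose_le:
  assumes "f \<in> dirichlet_algebra" "\<Phi> ` half_plane 0 \<subseteq> half_plane 0"
  shows "half_plane_norm (f \<circ> \<Phi>) \<le> half_plane_norm f"
  unfolding half_plane_norm_def
proof (rule cSUP_least)
  show "half_plane 0 \<noteq> {}" by (auto simp: half_plane_def intro: exI[of _ 1])
  fix s assume "s \<in> half_plane 0"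
  moreover have "bdd_above ((\<lambda>s. norm (f s)) ` half_plane 0)"
    using dirichlet_algebra_bounded[OF assms(1)] by (auto simp: bdd_above_def)
  ultimately show "norm ((f \<circ> \<Phi>) s) \<le> (SUP s\<in>half_plane 0. norm (f s))"
    using assms(2) cSUP_upper[of "\<Phi> s" "half_plane 0" "\<lambda>s. norm (f s)"] by auto
qed

text \<open>The test functions on which the operator is evaluated in passing from (a) to (c). On the
  half-plane the derivative is bounded by \<open>ln n\<close>, whence the Lipschitz
  estimate.\<close>

lemma nat_powr_dirichlet_algebra:
  assumes "n \<ge> 1"
  shows "(\<lambda>s. of_nat n powr (-s)) \<in> dirichlet_algebra"
proof -
  have "has_dirichlet_series (\<lambda>s. of_nat n powr (-s)) (\<lambda>k. if k = n then 1 else 0) (half_plane 0)"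
    unfolding has_dirichlet_series_def
  proof
    fix s :: complex
    have "(\<lambda>k. (if Suc k = n then 1 else 0) * of_nat (Suc k) powr (-s)) sums
        (\<Sum>k\<in>{n - 1}. (if Suc k = n then 1 else 0) * of_nat (Suc k) powr (-s))"
      by (rule sums_finite) (use assms in auto)
    then show "(\<lambda>k. (if Suc k = n then 1 else 0) * of_nat (Suc k) powr (-s)) sums (of_nat n powr (-s) :: complex)"
      using assms by (simp add: of_nat_1[unfolded One_nat_def] del: of_nat_Suc)
  qed
  moreover have "uniformly_continuous_on (half_plane 0) (\<lambda>s. (of_nat n :: complex) powr (-s))"
  proof -
    define l where "l = ln (real n)"
    have l: "l \<ge> 0" using assms by (simp add: l_def)
    have lip: "norm ((of_nat n :: complex) powr (-x) - of_nat n powr (-y)) \<le> l * norm (x - y)"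
      if "x \<in> half_plane 0" "y \<in> half_plane 0" for x y
    proof (rule field_differentiable_bound[OF convex_half_plane _ _ that])
      fix z :: complex assume z: "z \<in> half_plane 0"
      show "((\<lambda>s. of_nat n powr (-s)) has_field_derivative - (of_real l * exp (- z * of_real l))) (at z within half_plane 0)"
        unfolding of_nat_powr_eq_exp[OF assms] l_def[symmetric] by (auto intro!: derivative_eq_intros)
      have "exp (- (Re z * l)) \<le> 1" using z l by (simp add: half_plane_def)
      then show "norm (- (of_real l * exp (- z * of_real l))) \<le> l"
        using l by (simp add: norm_mult mult_left_le)
    qed
    show ?thesis
      unfolding uniformly_continuous_on_def
    proof (intro allI impI)
      fix e :: real assume "e > 0"
      show "\<exists>d>0. \<forall>x\<in>half_plane 0. \<forall>y\<in>half_plane 0. dist y x < d \<longrightarrow>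
          dist ((of_nat n :: complex) powr (-y)) (of_nat n powr (-x)) < e"
      \<comment> \<open>The 1 in l + 1 keeps the denominator positive for n = 1, where l =
        0.\<close>
      proof (intro exI[of _ "e / (l + 1)"] conjI ballI impI)
        fix x y assume xy: "x \<in> half_plane 0" "y \<in> half_plane 0" "dist y x < e / (l + 1)"
        have "dist ((of_nat n :: complex) powr (-y)) (of_nat n powr (-x)) \<le> l * dist y x"
          using lip[OF xy(2,1)] by (simp add: dist_norm)
        also have "\<dots> \<le> (l + 1) * dist y x" by (simp add: mult_right_mono)
        also have "\<dots> < e" using xy(3) l by (simp add: field_simps)
        finally show "dist ((of_nat n :: complex) powr (-y)) (of_nat n powr (-x)) < e" .
      qed (use \<open>e > 0\<close> l in auto)
    qed
  qed
  ultimately show ?thesis unfolding dirichlet_algebra_def by blast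
qed

theorem theorem2p13:
  fixes \<Phi> :: "complex \<Rightarrow> complex"
  assumes "\<Phi> analytic_on half_plane 0"
    and "\<Phi> ` half_plane 0 \<subseteq> half_plane 0"
  defines "a \<equiv> bounded_operator_on_algebra (composition_operator \<Phi>)"
    and "b \<equiv> \<Phi> \<in> G_algebra"
    and "c \<equiv> \<forall>n\<ge>1. nat_powr_neg n \<Phi> \<in> dirichlet_algebra"
    and "d \<equiv> \<Phi> \<in> G_infinity \<and> (\<forall>n\<ge>1. nat_powr_neg n \<Phi> \<in> dirichlet_algebra)"
    and "e \<equiv> \<Phi> \<in> G_infinity \<and> (\<exists>n\<ge>2. nat_powr_neg n \<Phi> \<in> dirichlet_algebra)"
  shows "(a \<longleftrightarrow> b) \<and> (a \<longleftrightarrow> c) \<and> (a \<longleftrightarrow> d) \<and> (a \<longleftrightarrow> e)"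
proof -
  have hol: "\<Phi> holomorphic_on half_plane 0" using assms(1) by (rule analytic_imp_holomorphic)
  have "a \<Longrightarrow> c"
  proof -
    assume a
    have "composition_operator \<Phi> (\<lambda>s. of_nat n powr (-s)) = nat_powr_neg n \<Phi>" for n
      by (auto simp: composition_operator_def nat_powr_neg_def)
    then show c
      using \<open>a\<close> nat_powr_dirichlet_algebra
      unfolding a_def c_def bounded_operator_on_algebra_def by metis
  qed
  moreover have "c \<Longrightarrow> d"
    using G_infinity_if_nat_powr_neg[OF assms(1,2)] unfolding c_def d_def by blast
  moreover have "d \<Longrightarrow> e"
    unfolding d_def e_def by (metis order_refl one_le_numeral)
  moreover have "e \<Longrightarrow> b"
    using uniformly_continuous_on_sublevel[OF hol]
    unfolding e_def b_def G_algebra_def dirichlet_algebra_def by blast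
  moreover have "b \<Longrightarrow> a"
  proof -
    assume b
    then have "f \<circ> \<Phi> \<in> dirichlet_algebra" if "f \<in> dirichlet_algebra" for f
      using dirichlet_algebra_compose that unfolding b_def by blast
    moreover have "half_plane_norm (f \<circ> \<Phi>) \<le> 1 * half_plane_norm f" if "f \<in> dirichlet_algebra" for f
      using half_plane_norm_compose_le[OF that assms(2)] by simp
    ultimately show a
      unfolding a_def bounded_operator_on_algebra_def composition_operator_def
      by (intro conjI exI[of _ 1]) auto
  qed
  ultimately show ?thesis by blast
qed

end
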